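(* Let $n,k,t$ be integers with $k\geq 2$, $1\leq t\leq 2k-2$ and $n\geq 318t^2k$. If $G$ is a $C_{2k+1}$-free graph on $n$ vertices with $d_2(G)\geq t$, then $$e(G)\leq \left\lfloor\frac{(n-t-1)^2}{4}\right\rfloor+\binom{t+2}{2},$$ with equality if and only if $G$ is isomorphic to $H(n,t)$.
   Context: All graphs are finite and simple. $e(G)$ denotes the number of edges of $G$. $G$ is $C_{2k+1}$-free if it contains no cycle of length $2k+1$ as a subgraph. $d_2(G)=\min\{|T|: T\subseteq V(G),\ G-T \text{ is bipartite}\}$, where $G-T$ is the subgraph induced by $V(G)\setminus T$. $T_2(m)$ denotes the complete bipartite graph on $m$ vertices with parts of sizes $\lfloor m/2\rfloor$ and $\lceil m/2\rceil$. $H(n,t)$ is the graph obtained from disjoint copies of $T_2(n-t-1)$ and $K_{t+2}$ by identifying one vertex of the first with one vertex of the second (so it has $n$ vertices). *)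

theory Defs
  imports Main
begin

record 'a ugraph =
  verts :: "'a set"
  edges :: "'a set set"

definition simple_graph :: "'a ugraph \<Rightarrow> bool" where
  "simple_graph G \<longleftrightarrow> finite (verts G) \<and> (\<forall>e\<in>edges G. e \<subseteq> verts G \<and> card e = 2)"

definition num_edges :: "'a ugraph \<Rightarrow> nat" where
  "num_edges G = card (edges G)"

text \<open>A cycle of length \<open>l\<close> is given by the list of its distinct vertices in cyclic order.
  It is a subgraph, not necessarily induced: chords are allowed.\<close>

definition has_cycle :: "nat \<Rightarrow> 'a ugraph \<Rightarrow> bool" where
  "has_cycle l G \<longleftrightarrow> l \<ge> 3 \<and> (\<exists>vs. length vs = l \<and> distinct vs \<and> set vs \<subseteq> verts G \<and>
     (\<forall>i<l. {vs ! i, vs ! (Suc i mod l)} \<in> edges G))"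

abbreviation cycle_free :: "nat \<Rightarrow> 'a ugraph \<Rightarrow> bool" where
  "cycle_free l G \<equiv> \<not> has_cycle l G"

definition bipartite :: "'a ugraph \<Rightarrow> bool" where
  "bipartite G \<longleftrightarrow> (\<exists>A B. A \<union> B = verts G \<and> A \<inter> B = {} \<and>
     (\<forall>e\<in>edges G. \<exists>a\<in>A. \<exists>b\<in>B. e = {a, b}))"

definition delete_verts :: "'a ugraph \<Rightarrow> 'a set \<Rightarrow> 'a ugraph" where
  "delete_verts G T =
     \<lparr>verts = verts G - T, edges = {e \<in> edges G. e \<subseteq> verts G - T}\<rparr>"

text \<open>For a finite graph the set below is finite and nonempty, since deleting all
  vertices leaves the empty graph, which is bipartite.\<close>

definition d2 :: "'a ugraph \<Rightarrow> nat" where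
  "d2 G = Min {card T | T. T \<subseteq> verts G \<and> bipartite (delete_verts G T)}"

definition graph_iso :: "'a ugraph \<Rightarrow> 'b ugraph \<Rightarrow> bool"  (infix "\<simeq>" 50) where
  "G \<simeq> H \<longleftrightarrow> (\<exists>f. bij_betw f (verts G) (verts H) \<and>
     (\<forall>u\<in>verts G. \<forall>v\<in>verts G. {u, v} \<in> edges G \<longleftrightarrow> {f u, f v} \<in> edges H))"

definition complete_graph :: "nat \<Rightarrow> nat ugraph" where
  "complete_graph m = \<lparr>verts = {..<m}, edges = {e. e \<subseteq> {..<m} \<and> card e = 2}\<rparr>"

text \<open>The parts \<open>{..<m div 2}\<close> and \<open>{m div 2..<m}\<close> have the floor and the ceiling of
  \<open>m / 2\<close> elements.\<close>

definition turan2 :: "nat \<Rightarrow> nat ugraph" where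
  "turan2 m = \<lparr>verts = {..<m}, edges = {{a, b} | a b. a < m div 2 \<and> m div 2 \<le> b \<and> b < m}\<rparr>"

text \<open>The disjoint union of \<open>G\<close> and \<open>H\<close> with the vertices \<open>u\<close> of \<open>G\<close> and \<open>w\<close> of \<open>H\<close>
  identified; the merged vertex is represented by \<open>Inl u\<close>.\<close>

definition glue :: "'a ugraph \<Rightarrow> 'a \<Rightarrow> 'b ugraph \<Rightarrow> 'b \<Rightarrow> ('a + 'b) ugraph" where
  "glue G u H w =
     (let f = (\<lambda>x. if x = w then Inl u else Inr x) in
      \<lparr>verts = Inl ` verts G \<union> f ` verts H,
       edges = (\<lambda>e. Inl ` e) ` edges G \<union> (\<lambda>e. f ` e) ` edges H\<rparr>)"

text \<open>\<open>H(n,t)\<close>: when \<open>n - t - 1\<close> is odd, the two parts of the complete bipartite graph have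
  different sizes, and choosing the identified vertex in one part or the other gives two
  non-isomorphic graphs (with equally many edges). \<open>H_graphs n t\<close> collects the graphs
  for all choices; up to isomorphism there is only one when \<open>n - t - 1\<close> is even.\<close>

definition H_graphs :: "nat \<Rightarrow> nat \<Rightarrow> (nat + nat) ugraph set" where
  "H_graphs n t = {glue (turan2 (n - t - 1)) u (complete_graph (t + 2)) w | u w.
     u \<in> verts (turan2 (n - t - 1)) \<and> w \<in> verts (complete_graph (t + 2))}"

end

theory Submission
  imports Defs
begin

text \<open>Among all vertex sets take \<open>S\<close> maximising \<open>e(S) - |S|\<^sup>2/5\<close>. Every vertex of \<open>S\<close> then has at
  least about \<open>2|S|/5\<close> neighbours in \<open>S\<close>, every other vertex at most that many, and \<open>|S|\<close> is linear
  in \<open>n\<close>. Three vertices of \<open>S\<close> always include two with many common neighbours, and a chain of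
  \<open>l + 1\<close> vertices, consecutive ones with many common neighbours, contains a path of length
  \<open>2l\<close>. Forbidding \<open>C\<^bsub>2k+1\<^esub>\<close> therefore first forces adjacent vertices of \<open>S\<close> to have few
  common neighbours, then any two vertices of a neighbourhood to have many, and finally excludes
  triangles and pentagons from \<open>S\<close>, which makes \<open>S\<close> bipartite. Comparing edge numbers again
  leaves only \<open>O(t)\<close> vertices outside \<open>S\<close>.

  No outside vertex sees both sides of \<open>S\<close>, and those with at least two neighbours in \<open>S\<close> can be
  added to \<open>S\<close> without losing bipartiteness. So at least \<open>t\<close> vertices \<open>R\<close> with at most one neighbour
  in \<open>S\<close> remain. As each added vertex misses about \<open>n/10\<close> of the edges it could have to \<open>S\<close>,
  the edge count permits only \<open>|R| = t + 1\<close> and no added vertex, with every inequality tight; the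
  vertices of \<open>R\<close> then attach to one common vertex, for otherwise there is a \<open>C\<^bsub>2k+1\<^esub>\<close> or deleting
  \<open>t - 1\<close> vertices leaves a bipartite graph.\<close>

section \<open>Paths from chains of common neighbours\<close>

lemma list_of_card:
  assumes "n \<le> card X"
  shows "\<exists>xs. distinct xs \<and> length xs = n \<and> set xs \<subseteq> X"
proof -
  obtain Y where "Y \<subseteq> X" "card Y = n" "finite Y"
    using assms obtain_subset_with_card_n by blast
  then show ?thesis by (metis distinct_card finite_distinct_list)
qed

locale sgraph =
  fixes V :: "'a set" and E :: "'a \<Rightarrow> 'a \<Rightarrow> bool"
  assumes finite_V: "finite V"
    and E_sym: "E x y \<Longrightarrow> E y x"
    and E_irrefl: "\<not> E x x"
    and E_V: "E x y \<Longrightarrow> x \<in> V"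
begin

lemma E_V2: "E x y \<Longrightarrow> y \<in> V"
  using E_sym E_V by blast

lemma E_commute: "E x y \<longleftrightarrow> E y x"
  using E_sym by blast

definition nb :: "'a \<Rightarrow> 'a set \<Rightarrow> 'a set" where
  "nb x S = {y \<in> S. E x y}"

definition linked :: "nat \<Rightarrow> 'a set \<Rightarrow> 'a \<Rightarrow> 'a \<Rightarrow> bool" where
  "linked K S x y \<longleftrightarrow> K \<le> card (nb x S \<inter> nb y S)"

definition indep :: "'a set \<Rightarrow> bool" where
  "indep S \<longleftrightarrow> (\<forall>x\<in>S. \<forall>y\<in>S. \<not> E x y)"

lemma nb_subset: "nb x S \<subseteq> S"
  by (auto simp: nb_def)

lemma finite_nb: "finite (nb x S)"
  by (rule finite_subset[OF _ finite_V]) (auto simp: nb_def E_V2)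

lemma linked_sym: "linked K S x y \<Longrightarrow> linked K S y x"
  by (simp add: linked_def Int_commute)

lemma zigzag_path:
  assumes "xs \<noteq> []" "distinct xs" "successively (linked K M) xs"
    and "finite Z" "card Z + 2 * length xs \<le> K"
  shows "\<exists>ys. length ys + 1 = 2 * length xs \<and> hd ys = hd xs \<and> last ys = last xs \<and> ys \<noteq> [] \<and>
    distinct ys \<and> successively E ys \<and> set ys \<inter> Z \<subseteq> set xs \<and> set ys \<subseteq> set xs \<union> M"
  using assms
proof (induction xs arbitrary: Z)
  case Nil
  then show ?case by simp
next
  case (Cons x xs)
  show ?case
  proof (cases xs)
    case Nil
    then show ?thesis by (intro exI[of _ "[x]"]) auto
  next
    case (Cons y xs')
    have lk: "linked K M x y" using Cons.prems(3) Cons by simp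
    have "card (insert x Z) \<le> Suc (card Z)"
      by (simp add: card_insert_le_m1 card_insert_if Cons.prems(4))
    then have "\<exists>ys. length ys + 1 = 2 * length xs \<and> hd ys = hd xs \<and> last ys = last xs \<and> ys \<noteq> [] \<and>
        distinct ys \<and> successively E ys \<and> set ys \<inter> insert x Z \<subseteq> set xs \<and> set ys \<subseteq> set xs \<union> M"
      using Cons.prems Cons by (intro Cons.IH) auto
    then obtain ys where ys: "length ys + 1 = 2 * length xs" "hd ys = hd xs" "last ys = last xs"
      "ys \<noteq> []" "distinct ys" "successively E ys" "set ys \<inter> insert x Z \<subseteq> set xs"
      "set ys \<subseteq> set xs \<union> M" by blast
    have xys: "x \<notin> set ys" using ys(7) Cons.prems(2) by auto
    \<comment> \<open>The tail path has \<open>2 * length xs - 1\<close> vertices, so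
      \<open>Z\<close>, \<open>x\<close> and this path block at most
      \<open>card Z + 2 * length xs\<close> vertices, fewer than \<open>K\<close>.\<close>
    have "card (Z \<union> insert x (set ys)) \<le> card Z + card (insert x (set ys))" by (rule card_Un_le)
    also have "card (insert x (set ys)) = Suc (length ys)"
      using xys ys(5) by (simp add: distinct_card)
    finally have "card (Z \<union> insert x (set ys)) < card (nb x M \<inter> nb y M)"
      using lk Cons.prems(5) ys(1) unfolding linked_def by simp
    then have "\<not> nb x M \<inter> nb y M \<subseteq> Z \<union> insert x (set ys)"
      by (meson Cons.prems(4) List.finite_set card_mono finite.insertI finite_UnI not_le)
    then obtain z where z: "z \<in> nb x M" "z \<in> nb y M" "z \<notin> Z" "z \<noteq> x" "z \<notin> set ys" by blast
    have "E z y" "E x z" "z \<in> M" using z by (auto simp: nb_def intro: E_sym)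
    then show ?thesis
      using ys xys z Cons
      by (intro exI[of _ "x # z # ys"]) (auto simp: successively_Cons)
  qed
qed

lemma clique_path:
  assumes "finite X" "x \<in> X" "y \<in> X" "x \<noteq> y" "1 \<le> l" "l + 1 \<le> card X"
    and "\<And>u v. u \<in> X \<Longrightarrow> v \<in> X \<Longrightarrow> u \<noteq> v \<Longrightarrow> F u v"
  shows "\<exists>xs. distinct xs \<and> length xs = l + 1 \<and> set xs \<subseteq> X \<and> hd xs = x \<and> last xs = y \<and>
    successively F xs"
proof -
  have "l - 1 \<le> card (X - {x, y})" using assms by (simp add: card_Diff_subset)
  then obtain zs where zs: "distinct zs" "length zs = l - 1" "set zs \<subseteq> X - {x, y}"
    using list_of_card by blast
  let ?xs = "x # zs @ [y]"
  have d: "distinct ?xs" "set ?xs \<subseteq> X" using zs assms by auto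
  have "successively F zs'" if "distinct zs'" "set zs' \<subseteq> X" for zs'
    using that by (induction zs' rule: induct_list012) (auto intro: assms(7))
  with d have "successively F ?xs" by blast
  then show ?thesis using d zs assms(5) by (intro exI[of _ ?xs]) auto
qed

lemma clique_even_path:
  assumes "finite X" "x \<in> X" "y \<in> X" "x \<noteq> y" "1 \<le> l" "l + 1 \<le> card X"
    and "\<And>u v. u \<in> X \<Longrightarrow> v \<in> X \<Longrightarrow> u \<noteq> v \<Longrightarrow> linked K M u v"
    and "finite Z" "card Z + 2 * l + 2 \<le> K"
  shows "\<exists>ys. length ys = 2 * l + 1 \<and> hd ys = x \<and> last ys = y \<and>
    distinct ys \<and> successively E ys \<and> set ys \<inter> Z \<subseteq> X \<and> set ys \<subseteq> X \<union> M"
proof -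
  obtain xs where xs: "distinct xs" "length xs = l + 1" "set xs \<subseteq> X" "hd xs = x" "last xs = y"
    "successively (linked K M) xs"
    using clique_path[OF assms(1-6), of "linked K M"] assms(7) by blast
  then have "xs \<noteq> []" by auto
  from zigzag_path[OF this xs(1,6) assms(8)] xs assms(9) show ?thesis
    by fastforce
qed

end

text \<open>If some vertex has \<open>k\<close> non-neighbours, any two of these are related, so
  they can be listed in any order. Otherwise every vertex has fewer than \<open>k\<close>
  non-neighbours, and a path on fewer than \<open>k\<close> vertices always extends at its
  head.\<close>

lemma no_independent_triple_path:
  assumes "finite W" "2 * k \<le> card W" and sym: "\<And>x y. F x y \<Longrightarrow> F y x"
    and triple: "\<And>x y z. \<lbrakk>x \<in> W; y \<in> W; z \<in> W; x \<noteq> y; y \<noteq> z; x \<noteq> z\<rbrakk> \<Longrightarrow> F x y \<or> F y z \<or> F x z"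
  shows "\<exists>xs. distinct xs \<and> length xs = k \<and> set xs \<subseteq> W \<and> successively F xs"
proof (cases "\<exists>x\<in>W. k \<le> card {y \<in> W. y \<noteq> x \<and> \<not> F x y}")
  case True
  then obtain x where x: "x \<in> W" "k \<le> card {y \<in> W. y \<noteq> x \<and> \<not> F x y}" by blast
  let ?Q = "{y \<in> W. y \<noteq> x \<and> \<not> F x y}"
  obtain xs where xs: "distinct xs" "set xs \<subseteq> ?Q" "length xs = k"
    using list_of_card[OF x(2)] by blast
  have "successively F zs" if "distinct zs" "set zs \<subseteq> ?Q" for zs
    using that
  proof (induction zs rule: induct_list012)
    case (3 u v zs)
    then show ?case using triple[of x u v] x(1) by auto
  qed auto
  with xs show ?thesis by blast
next
  case False
  have "\<exists>xs. distinct xs \<and> length xs = j \<and> set xs \<subseteq> W \<and> successively F xs" if "j \<le> k" for j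
    using that
  proof (induction j)
    case (Suc j)
    then obtain xs where xs: "distinct xs" "length xs = j" "set xs \<subseteq> W" "successively F xs"
      by auto
    show ?case
    proof (cases xs)
      case Nil
      have "W \<noteq> {}" using assms(2) Suc.prems by auto
      then obtain w where "w \<in> W" by blast
      then show ?thesis using Nil xs(2) by (intro exI[of _ "[w]"]) auto
    next
      case (Cons x xs')
      let ?N = "{y \<in> W. y \<noteq> x \<and> \<not> F x y}"
      have "card ?N < k" using False xs(3) Cons by auto
      moreover have "card (set xs \<union> ?N) \<le> card (set xs) + card ?N" by (rule card_Un_le)
      moreover have "card (set xs) = j" using xs by (simp add: distinct_card)
      ultimately have "card (set xs \<union> ?N) < card W" using assms(2) Suc.prems by linarith
      then have "\<not> W \<subseteq> set xs \<union> ?N"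
        using card_mono[of "set xs \<union> ?N" W] assms(1) by auto
      then obtain y where "y \<in> W" "y \<notin> set xs" "F x y" using Cons by auto
      then show ?thesis using xs Cons
        by (intro exI[of _ "y # xs"]) (auto intro: sym)
    qed
  qed auto
  then show ?thesis by blast
qed

section \<open>Dense graphs without the odd cycle are bipartite\<close>

locale cycle_free_graph = sgraph +
  fixes k :: nat
  assumes k_ge: "2 \<le> k"
    and no_cycle: "\<lbrakk>length vs = 2 * k + 1; distinct vs; successively E vs\<rbrakk> \<Longrightarrow> \<not> E (last vs) (hd vs)"
begin

text \<open>This and the next two lemmas close a path on \<open>2 * k\<close>,
  \<open>2 * k - 1\<close> or \<open>2 * k - 2\<close> vertices through one, two or three further
  vertices, so that later proofs only have to supply the path.\<close>

lemma no_cycle1: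
  assumes "length vs = 2 * k" "distinct vs" "successively E vs" "r \<notin> set vs" "E r (hd vs)"
  shows "\<not> E (last vs) r"
proof -
  have "vs \<noteq> []" using assms(1) k_ge by auto
  then show ?thesis
    using no_cycle[of "r # vs"] assms by (auto simp: successively_Cons)
qed

lemma no_cycle2:
  assumes "length vs + 1 = 2 * k" "distinct vs" "successively E vs" "r \<notin> set vs" "s \<notin> set vs"
    "r \<noteq> s" "E r (hd vs)" "E (last vs) s"
  shows "\<not> E s r"
proof -
  have "vs \<noteq> []" using assms(1) k_ge by auto
  then show ?thesis
    using no_cycle1[of "vs @ [s]" r] assms by (auto simp: successively_append_iff)
qed

lemma no_cycle3:
  assumes "length vs + 2 = 2 * k" "distinct vs" "vs \<noteq> []" "successively E vs"
    "r \<notin> set vs" "s \<notin> set vs" "q \<notin> set vs"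
    "r \<noteq> s" "r \<noteq> q" "q \<noteq> s" "E r (hd vs)" "E (last vs) s" "E s q"
  shows "\<not> E q r"
proof -
  show ?thesis
    using no_cycle2[of "vs @ [s]" r q] assms by (auto simp: successively_append_iff)
qed

end

locale dense_part = cycle_free_graph +
  fixes S :: "'a set"
  assumes S_V: "S \<subseteq> V"
    and S_large: "100 * k \<le> card S"
    and S_deg: "v \<in> S \<Longrightarrow> 2 * card S \<le> 5 * card (nb v S) + 1"
begin

lemma finite_S: "finite S"
  using S_V finite_V finite_subset by blast

text \<open>Three neighbourhoods have total size about 6/5 of \<open>card S\<close>. The excess over
  \<open>card S\<close>, about \<open>20 * k\<close> or more, must be absorbed by the three pairwise
  intersections.\<close>

lemma linked_triple:
  assumes "x \<in> S" "y \<in> S" "z \<in> S"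
  shows "linked (3 * k) S x y \<or> linked (3 * k) S y z \<or> linked (3 * k) S x z"
proof (rule ccontr)
  assume "\<not> ?thesis"
  then have *: "card (nb x S \<inter> nb y S) < 3 * k" "card (nb y S \<inter> nb z S) < 3 * k"
    "card (nb x S \<inter> nb z S) < 3 * k" by (auto simp: linked_def)
  note f = finite_nb[of _ S]
  have "card (nb x S) + card (nb y S) = card (nb x S \<union> nb y S) + card (nb x S \<inter> nb y S)"
    by (rule card_Un_Int[OF f f])
  moreover have "card (nb x S \<union> nb y S) + card (nb z S) =
     card (nb x S \<union> nb y S \<union> nb z S) + card ((nb x S \<union> nb y S) \<inter> nb z S)"
    by (rule card_Un_Int) (auto simp: f)
  moreover have "card ((nb x S \<union> nb y S) \<inter> nb z S) \<le> card (nb x S \<inter> nb z S) + card (nb y S \<inter> nb z S)"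
    by (simp add: Int_Un_distrib2 card_Un_le)
  moreover have "card (nb x S \<union> nb y S \<union> nb z S) \<le> card S"
    by (rule card_mono[OF finite_S]) (auto simp: nb_def)
  ultimately show False
    using * S_deg[OF assms(1)] S_deg[OF assms(2)] S_deg[OF assms(3)] S_large k_ge by linarith
qed

text \<open>Otherwise the common neighbourhood contains a chain of \<open>k\<close> linked vertices.
  It expands to a path on \<open>2 * k - 1\<close> vertices avoiding \<open>u\<close> and
  \<open>v\<close>, which the edge \<open>uv\<close> closes to the forbidden cycle.\<close>

lemma adjacent_few_common:
  assumes "u \<in> S" "v \<in> S" "E u v"
  shows "card (nb u S \<inter> nb v S) < 2 * k"
proof (rule ccontr)
  assume a: "\<not> ?thesis"
  let ?W = "nb u S \<inter> nb v S"
  have "\<exists>xs. distinct xs \<and> length xs = k \<and> set xs \<subseteq> ?W \<and> successively (linked (3 * k) S) xs"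
  proof (rule no_independent_triple_path)
    show "finite ?W" by (simp add: finite_nb)
    show "2 * k \<le> card ?W" using a by simp
    show "linked (3 * k) S y x" if "linked (3 * k) S x y" for x y using that by (rule linked_sym)
    show "linked (3 * k) S x y \<or> linked (3 * k) S y z \<or> linked (3 * k) S x z"
      if "x \<in> ?W" "y \<in> ?W" "z \<in> ?W" for x y z
      using that by (intro linked_triple) (auto simp: nb_def)
  qed
  then obtain xs where xs: "distinct xs" "length xs = k" "set xs \<subseteq> ?W"
    "successively (linked (3 * k) S) xs" by blast
  have "card {u, v} + 2 * length xs \<le> 3 * k"
    using xs(2) k_ge card_length[of "[u, v]"] by simp
  moreover have "xs \<noteq> []" using xs(2) k_ge by auto
  ultimately obtain ys where ys: "length ys + 1 = 2 * length xs" "hd ys = hd xs" "last ys = last xs"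
      "ys \<noteq> []" "distinct ys" "successively E ys" "set ys \<inter> {u, v} \<subseteq> set xs"
    using zigzag_path[of xs "3 * k" S "{u, v}"] xs by auto
  have uv: "u \<notin> set xs" "v \<notin> set xs" using xs(3) by (auto simp: nb_def E_irrefl)
  have "E u (hd ys)" "E (last ys) v"
    using ys(2,3) subsetD[OF xs(3) hd_in_set] subsetD[OF xs(3) last_in_set] \<open>xs \<noteq> []\<close>
    by (auto simp: nb_def E_commute)
  moreover have "u \<notin> set ys" "v \<notin> set ys" using ys(7) uv by auto
  moreover have "u \<noteq> v" using assms(3) E_irrefl by auto
  ultimately show False
    using no_cycle2[of ys u v] ys xs(2) assms(3) by (simp add: E_commute)
qed

text \<open>The neighbourhoods of \<open>a\<close> and \<open>b\<close> meet that of
  \<open>u\<close> in fewer than \<open>2 * k\<close> vertices, so almost all of both lies in the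
  remaining 3/5 of \<open>S\<close>. Two sets of about 2/5 overlap there in about 1/5.\<close>

lemma nb_linked:
  assumes "u \<in> S" "a \<in> nb u S" "b \<in> nb u S"
  shows "linked (3 * k) S a b"
proof -
  let ?N = "nb u S"
  have aS: "a \<in> S" "b \<in> S" "E u a" "E u b" using assms by (auto simp: nb_def)
  have *: "card (nb a S) \<le> card (nb a S - ?N) + 2 * k" if "a \<in> S" "E u a" for a
  proof -
    have "card (nb a S) = card (nb a S - ?N) + card (nb u S \<inter> nb a S)"
      using card_Diff_subset_Int[of "nb a S" ?N] card_mono[of "nb a S" "nb a S \<inter> ?N"]
      by (simp add: finite_nb Int_commute)
    with adjacent_few_common[OF assms(1) that] show ?thesis by simp
  qed
  have "card (nb a S - ?N) + card (nb b S - ?N) =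
    card ((nb a S - ?N) \<union> (nb b S - ?N)) + card ((nb a S - ?N) \<inter> (nb b S - ?N))"
    by (rule card_Un_Int) (auto simp: finite_nb)
  moreover have "card ((nb a S - ?N) \<union> (nb b S - ?N)) \<le> card (S - ?N)"
    by (rule card_mono) (auto simp: finite_S nb_def)
  moreover have "card (S - ?N) + card ?N = card S"
    using card_Diff_subset[of ?N S] card_mono[of S ?N] finite_S
    by (simp add: finite_nb nb_subset)
  moreover have "card ((nb a S - ?N) \<inter> (nb b S - ?N)) \<le> card (nb a S \<inter> nb b S)"
    by (rule card_mono) (auto simp: finite_nb)
  ultimately show ?thesis
    using *[OF aS(1,3)] *[OF aS(2,4)] S_deg[OF assms(1)] S_deg[OF aS(1)] S_deg[OF aS(2)] S_large k_ge
    unfolding linked_def by linarith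
qed

lemma card_nb_large:
  assumes "u \<in> S"
  shows "3 * k \<le> card (nb u S)"
  using S_deg[OF assms] S_large k_ge by linarith

text \<open>All pairs in the neighbourhood of \<open>v\<close> are linked, so \<open>u\<close> and
  \<open>w\<close> are joined by a path with \<open>2 * k\<close> edges, which the edge
  \<open>uw\<close> closes. It does not matter whether the path visits \<open>v\<close>.\<close>

lemma triangle_free:
  assumes "u \<in> S" "v \<in> S" "w \<in> S" "E u v" "E v w"
  shows "\<not> E u w"
proof
  assume uw: "E u w"
  let ?X = "nb v S"
  have "\<exists>ys. length ys = 2 * k + 1 \<and> hd ys = u \<and> last ys = w \<and>
    distinct ys \<and> successively E ys \<and> set ys \<inter> {} \<subseteq> ?X \<and> set ys \<subseteq> ?X \<union> S"
    using assms uw k_ge card_nb_large[OF assms(2)]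
    by (intro clique_even_path[where K = "3 * k"] finite_nb nb_linked[OF assms(2)])
      (auto simp: nb_def E_irrefl E_commute)
  then show False using no_cycle uw E_commute by metis
qed

text \<open>A chain of \<open>k\<close> neighbours of \<open>a\<close> leads from \<open>w\<close>
  to \<open>u\<close>, and \<open>u\<close> is linked to \<open>w'\<close> through their common
  neighbour \<open>b\<close>. The resulting chain of \<open>k + 1\<close> vertices gives a path on
  \<open>2 * k + 1\<close> vertices, closed by the edge between \<open>w'\<close> and
  \<open>w\<close>.\<close>

lemma pentagon_free:
  assumes "w \<in> S" "a \<in> S" "u \<in> S" "b \<in> S" "w' \<in> S" "E w a" "E a u" "E u b" "E b w'" "w \<noteq> u"
  shows "\<not> E w' w"
proof
  assume ww: "E w' w"
  have ne: "u \<noteq> w'" "w \<noteq> w'"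
    using triangle_free[of u w a] assms ww E_commute E_irrefl by metis+
  \<comment> \<open>Leaving out \<open>w'\<close> keeps the chain distinct when \<open>w'\<close> is
    appended.\<close>
  let ?X = "nb a S - {w'}"
  have "card (nb a S) \<le> card ?X + 1"
    by (auto simp: card_Diff_singleton_if)
  then have "\<exists>xs. distinct xs \<and> length xs = k - 1 + 1 \<and> set xs \<subseteq> ?X \<and> hd xs = w \<and> last xs = u \<and>
    successively (linked (3 * k) S) xs"
    using assms ne k_ge card_nb_large[OF assms(2)]
    by (intro clique_path) (auto simp: nb_def finite_S finite_nb E_commute intro!: nb_linked[of a])
  then obtain xs where xs: "distinct xs" "length xs = k" "set xs \<subseteq> ?X" "hd xs = w" "last xs = u"
    "successively (linked (3 * k) S) xs" using k_ge by auto
  have "linked (3 * k) S u w'"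
    using assms by (intro nb_linked[of b]) (auto simp: nb_def E_commute)
  moreover have "xs \<noteq> []" using xs(2) k_ge by auto
  ultimately have "successively (linked (3 * k) S) (xs @ [w'])" "distinct (xs @ [w'])"
    using xs by (auto simp: successively_append_iff)
  then obtain ys where ys: "length ys + 1 = 2 * length (xs @ [w'])" "hd ys = w" "last ys = w'"
      "distinct ys" "successively E ys"
    using zigzag_path[of "xs @ [w']" "3 * k" S "{}"] xs(2,4) k_ge \<open>xs \<noteq> []\<close>
    by (simp del: distinct_append) blast
  then show False using no_cycle[of ys] xs(2) ww by auto
qed

text \<open>Fix an edge \<open>uv\<close> and sort vertices by whether a walk of two steps leads to
  \<open>u\<close> or to \<open>v\<close>. A vertex with neither walk would give three disjoint
  neighbourhoods, each of about 2/5 of \<open>S\<close>. A vertex with both, or an edge inside a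
  class, closes a triangle or a pentagon.\<close>

lemma bipartition:
  obtains A B where "A \<union> B = S" "A \<inter> B = {}" "indep A" "indep B"
proof -
  have "S \<noteq> {}" using S_large k_ge by auto
  then obtain u where u: "u \<in> S" by blast
  have "nb u S \<noteq> {}" using card_nb_large[OF u] k_ge by auto
  then obtain v where v: "v \<in> S" "E u v" by (auto simp: nb_def)
  let ?A = "{w \<in> S. \<exists>z\<in>S. E w z \<and> E z u}"
  let ?B = "{w \<in> S. \<exists>z\<in>S. E w z \<and> E z v}"
  have disj: "nb u S \<inter> nb v S = {}"
    using triangle_free[OF u v(1) _ v(2)] E_commute unfolding nb_def by blast
  have "w \<in> ?A \<union> ?B" if w: "w \<in> S" for w
  proof (rule ccontr)
    assume "w \<notin> ?A \<union> ?B"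
    then have d: "nb w S \<inter> (nb u S \<union> nb v S) = {}"
      using w unfolding nb_def by (auto dest: E_sym)
    have "card (nb w S) + (card (nb u S) + card (nb v S)) = card (nb w S \<union> (nb u S \<union> nb v S))"
      using d disj by (simp add: card_Un_disjoint finite_nb)
    also have "\<dots> \<le> card S"
      by (rule card_mono[OF finite_S]) (auto simp: nb_def)
    finally show False
      using S_deg[OF u] S_deg[OF v(1)] S_deg[OF w] S_large k_ge by linarith
  qed
  then have "?A \<union> ?B = S" by auto
  moreover have "?A \<inter> ?B = {}"
  proof -
    have False if "w \<in> S" "z \<in> S" "z' \<in> S" "E w z" "E z u" "E w z'" "E z' v" for w z z'
    proof -
      show False
      proof (cases "u = w")
        case True
        then show ?thesis using triangle_free[of u v z'] that u v E_commute by metis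
      next
        case False
        then show ?thesis
          using pentagon_free[of u z w z' v] that u v E_commute by metis
      qed
    qed
    then show ?thesis by blast
  qed
  moreover have "indep {w \<in> S. \<exists>z\<in>S. E w z \<and> E z u}" if "u \<in> S" for u
    unfolding indep_def
  proof (intro ballI notI)
    fix x y assume "x \<in> {w \<in> S. \<exists>z\<in>S. E w z \<and> E z u}" "y \<in> {w \<in> S. \<exists>z\<in>S. E w z \<and> E z u}" "E x y"
    then obtain a b where ab: "x \<in> S" "y \<in> S" "a \<in> S" "b \<in> S" "E x a" "E a u" "E y b" "E b u" "E x y"
      by blast
    show False
    proof (cases "x = u")
      case True
      then show ?thesis using triangle_free[of y b u] ab that E_commute by metis
    next
      case False
      then show ?thesis using pentagon_free[of x a u b y] ab that E_commute by metis
    qed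
  qed
  ultimately show thesis using that[of ?A ?B] u v(1) by blast
qed

end

section \<open>Counting edges\<close>

context sgraph
begin

text \<open>Counts ordered adjacent pairs: \<open>pairs S S\<close> is twice the number of edges
  inside \<open>S\<close>, while for disjoint sets each edge between them counts once.\<close>

definition pairs :: "'a set \<Rightarrow> 'a set \<Rightarrow> nat" where
  "pairs S T = (\<Sum>x\<in>S. card (nb x T))"

lemma nb_Un: "nb x (S \<union> T) = nb x S \<union> nb x T"
  by (auto simp: nb_def)

lemma card_nb_le: "finite S \<Longrightarrow> card (nb x S) \<le> card S"
  by (rule card_mono) (auto simp: nb_def)

lemma pairs_commute:
  assumes "finite S" "finite T"
  shows "pairs S T = pairs T S"
proof -
  have *: "card (nb x T) = (\<Sum>y\<in>T. if E x y then 1 else 0)" if "finite T" for x T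
    using that by (simp add: nb_def sum.If_cases Int_def)
  have "pairs S T = (\<Sum>x\<in>S. \<Sum>y\<in>T. if E x y then 1 else 0)"
    by (simp add: pairs_def * assms)
  also have "\<dots> = (\<Sum>y\<in>T. \<Sum>x\<in>S. if E y x then 1 else 0)"
    by (subst sum.swap) (simp add: E_commute)
  finally show ?thesis by (simp add: pairs_def * assms)
qed

lemma pairs_Un_left:
  "finite S \<Longrightarrow> finite T \<Longrightarrow> S \<inter> T = {} \<Longrightarrow> pairs (S \<union> T) U = pairs S U + pairs T U"
  by (simp add: pairs_def sum.union_disjoint)

lemma pairs_Un:
  assumes "finite S" "finite T" "S \<inter> T = {}"
  shows "pairs (S \<union> T) (S \<union> T) = pairs S S + 2 * pairs S T + pairs T T"
proof -
  have "pairs (S \<union> T) (S \<union> T) = pairs S (S \<union> T) + pairs T (S \<union> T)"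
    using assms by (rule pairs_Un_left)
  moreover have "pairs U (S \<union> T) = pairs U S + pairs U T" if "finite U" for U
    using assms that pairs_Un_left[of S T U] by (simp add: pairs_commute[of U])
  ultimately show ?thesis using assms pairs_commute[of S T] by simp
qed

lemma pairs_insert:
  assumes "finite T" "v \<notin> T"
  shows "pairs (insert v T) (insert v T) = pairs T T + 2 * card (nb v T)"
proof -
  have "pairs {v} {v} = 0" by (simp add: pairs_def nb_def E_irrefl)
  then show ?thesis
    using pairs_Un[of "{v}" T] assms by (simp add: pairs_def)
qed

lemma pairs_le:
  assumes "\<And>x. x \<in> S \<Longrightarrow> card (nb x T) \<le> d"
  shows "pairs S T \<le> card S * d"
  using sum_bounded_above[of S "\<lambda>x. card (nb x T)" d] assms by (simp add: pairs_def)

lemma pairs_le_card: "finite T \<Longrightarrow> pairs S T \<le> card S * card T"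
  by (rule pairs_le) (rule card_nb_le)

lemma card_nb_self_le:
  assumes "finite S" "x \<in> S"
  shows "card (nb x S) \<le> card S - 1"
proof -
  have "card (nb x S) \<le> card (S - {x})"
    by (rule card_mono) (use assms in \<open>auto simp: nb_def E_irrefl\<close>)
  then show ?thesis using assms by simp
qed

lemma indep_pairs:
  assumes "indep A"
  shows "pairs A A = 0"
proof -
  have "nb x A = {}" if "x \<in> A" for x using assms that by (auto simp: indep_def nb_def)
  then show ?thesis by (simp add: pairs_def)
qed

text \<open>The maximised quantity is ten times \<open>e(S) - |S|^2 / 5\<close>, kept integral.
  Comparison with one vertex deleted or added gives the degree bounds, where the slack 1 comes from
  the difference of consecutive squares; comparison with \<open>V\<close> gives the last
  bound.\<close>

lemma ex_max_density:
  obtains S where "S \<subseteq> V"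
    "\<And>v. v \<in> S \<Longrightarrow> 2 * card S \<le> 5 * card (nb v S) + 1"
    "\<And>v. v \<in> V \<Longrightarrow> v \<notin> S \<Longrightarrow> 5 * card (nb v S) \<le> 2 * card S + 1"
    "5 * pairs V V + 2 * (card S)\<^sup>2 \<le> 5 * pairs S S + 2 * (card V)\<^sup>2"
proof -
  let ?f = "\<lambda>S. 5 * int (pairs S S) - 2 * (int (card S))\<^sup>2"
  have fin_im: "finite (?f ` Pow V)" using finite_V by simp
  have "Max (?f ` Pow V) \<in> ?f ` Pow V" by (rule Max_in[OF fin_im]) auto
  then obtain S where S1: "S \<in> Pow V" "Max (?f ` Pow V) = ?f S" by (rule imageE)
  have S: "?f T \<le> ?f S" if "T \<subseteq> V" for T
    using Max_ge[OF fin_im imageI[of T "Pow V" ?f]] S1 that by auto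
  have fin: "finite S" using S1(1) finite_V finite_subset by blast
  show thesis
  proof (rule that)
    show "S \<subseteq> V" using S1 by simp
  next
    fix v assume v: "v \<in> S"
    have ins: "S = insert v (S - {v})" using v by auto
    have "nb v (S - {v}) = nb v S" by (auto simp: nb_def E_irrefl)
    then have "pairs S S = pairs (S - {v}) (S - {v}) + 2 * card (nb v S)"
      using pairs_insert[of "S - {v}" v] fin ins by simp
    moreover have "int (card S) = int (card (S - {v})) + 1"
      using card_Suc_Diff1[OF fin v] by linarith
    moreover have "?f (S - {v}) \<le> ?f S" by (rule S) (use S1 in auto)
    ultimately have "2 * int (card S) \<le> 5 * int (card (nb v S)) + 1"
      by (simp add: power2_eq_square algebra_simps)
    then show "2 * card S \<le> 5 * card (nb v S) + 1" by linarith
  next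
    fix v assume v: "v \<in> V" "v \<notin> S"
    have "pairs (insert v S) (insert v S) = pairs S S + 2 * card (nb v S)"
      using pairs_insert[of S v] fin v by simp
    moreover have "int (card (insert v S)) = int (card S) + 1"
      using fin v by simp
    moreover have "?f (insert v S) \<le> ?f S" by (rule S) (use S1 v in auto)
    ultimately have "5 * int (card (nb v S)) \<le> 2 * int (card S) + 1"
      by (simp add: power2_eq_square algebra_simps)
    then show "5 * card (nb v S) \<le> 2 * card S + 1" by linarith
  next
    have "?f V \<le> ?f S" by (rule S) (use S1 in auto)
    then have "int (5 * pairs V V + 2 * (card S)\<^sup>2) \<le> int (5 * pairs S S + 2 * (card V)\<^sup>2)"
      by simp
    then show "5 * pairs V V + 2 * (card S)\<^sup>2 \<le> 5 * pairs S S + 2 * (card V)\<^sup>2"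
      by linarith
  qed
qed

end

section \<open>Integer inequalities behind the edge counts\<close>

lemma div4_square_ge: "(N::nat)\<^sup>2 \<le> 4 * (N\<^sup>2 div 4) + 1"
proof (cases "even N")
  case True
  then obtain c where "N = 2 * c" by blast
  then show ?thesis by (simp add: power2_eq_square)
next
  case False
  then obtain c where "N = 2 * c + 1" by (rule oddE)
  moreover define d where "d = c * c + c"
  ultimately have "N\<^sup>2 = 4 * d + 1" by (simp add: power2_eq_square algebra_simps)
  then show ?thesis by presburger
qed

text \<open>Doubling removes the floor at the cost of 1 and leaves a polynomial inequality over the
  integers.\<close>

lemma edge_bound_int:
  fixes p n t :: nat
  assumes "2 * ((n - t - 1)\<^sup>2 div 4) + (t + 1) * (t + 2) \<le> p" "t + 1 \<le> n"
  shows "(int n - int t - 1)\<^sup>2 - 1 + 2 * (int t + 1) * (int t + 2) \<le> 2 * int p"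
proof -
  have "(n - t - 1)\<^sup>2 + 2 * ((t + 1) * (t + 2)) \<le> 2 * p + 1"
    using assms(1) div4_square_ge[of "n - t - 1"] by linarith
  then have "int ((n - t - 1)\<^sup>2 + 2 * ((t + 1) * (t + 2))) \<le> int (2 * p + 1)"
    by linarith
  moreover have "int (n - t - 1) = int n - int t - 1" using assms(2) by simp
  ultimately show ?thesis by (simp add: algebra_simps)
qed

text \<open>Here \<open>n = |V|\<close> and \<open>m = |S|\<close>, while \<open>p\<close> and
  \<open>s\<close> are twice the numbers of edges of the whole graph and of \<open>S\<close>. The
  bound on \<open>s\<close> is first the trivial one and then the one for bipartite
  \<open>S\<close>.\<close>

lemma max_density_large:
  fixes n t k m p s :: int
  assumes "2 \<le> k" "1 \<le> t" "318 * t\<^sup>2 * k \<le> n" "0 \<le> m" "m \<le> n"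
    and p: "(n - t - 1)\<^sup>2 - 1 + 2 * (t + 1) * (t + 2) \<le> 2 * p"
    and ps: "5 * p + 2 * m\<^sup>2 \<le> 5 * s + 2 * n\<^sup>2"
  shows "s \<le> m\<^sup>2 \<Longrightarrow> 100 * k \<le> m" and "2 * s \<le> m\<^sup>2 \<Longrightarrow> 100 * k \<le> m \<Longrightarrow> n - m \<le> 15 * t"
    and "636 * t\<^sup>2 \<le> n"
proof -
  have tt: "t \<le> t\<^sup>2" using assms(2) by (simp add: power2_eq_square)
  have "t\<^sup>2 * 2 \<le> t\<^sup>2 * k" using assms(1) by (intro mult_left_mono) auto
  then show n636: "636 * t\<^sup>2 \<le> n" using assms(3) by simp
  have "1 * k \<le> t\<^sup>2 * k" using assms(1) tt assms(2) by (intro mult_right_mono) auto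
  then have n318: "318 * k \<le> n" using assms(3) by simp
  have n0: "0 < n" using n318 assms(1) by simp
  have "636 * t \<le> n" using n636 tt by simp
  then have tn: "636 * t * n \<le> n * n" using n0 by simp
  have t1n: "n * t \<ge> n * 1" using assms(2) n0 by (intro mult_left_mono) auto
  have "(n - t - 1)\<^sup>2 - 1 + 2 * (t + 1) * (t + 2) = n * n - 2 * n * t - 2 * n + 3 * (t * t) + 8 * t + 4"
    by (simp add: power2_eq_square algebra_simps)
  moreover have "0 \<le> t * t" by simp
  ultimately have pn: "n * n - 4 * (n * t) \<le> 2 * p" using p t1n assms(2) by linarith
  have *: "n * n - 20 * (n * t) + 4 * (m * m) \<le> 10 * s"
    using pn ps by (simp add: power2_eq_square)
  \<comment> \<open>If \<open>5 * m < 2 * n\<close>, then \<open>6 * m^2\<close> is at most 24/25 of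
    \<open>n^2\<close>. But the loss \<open>20 * n * t\<close> is at most 20/636 of
    \<open>n^2\<close>, which is below 1/25.\<close>
  have large: "2 * n \<le> 5 * m" if "s \<le> m\<^sup>2"
  proof (rule ccontr)
    assume "\<not> 2 * n \<le> 5 * m"
    then have "(5 * m) * (5 * m) \<le> (2 * n) * (2 * n)" using assms(4) by (intro mult_mono[of "5 * m"]) auto
    then have "25 * (m * m) \<le> 4 * (n * n)" by simp
    moreover have "n * n - 20 * (n * t) \<le> 6 * (m * m)" using * that by (simp add: power2_eq_square)
    moreover have "636 * (n * t) \<le> n * n" using tn by (simp add: algebra_simps)
    moreover have "0 < n * n" using n0 by simp
    ultimately show False by linarith
  qed
  show "100 * k \<le> m" if "s \<le> m\<^sup>2" using large[OF that] n318 assms(1) by linarith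
  \<comment> \<open>Now \<open>(n + m) * (n - m)\<close> is at most \<open>20 * n * t\<close>. Since
    \<open>n + m\<close> is at least \<open>7 * n / 5\<close>, this gives \<open>n - m\<close> at
    most \<open>100 * t / 7\<close>.\<close>
  show "n - m \<le> 15 * t" if "2 * s \<le> m\<^sup>2" "100 * k \<le> m"
  proof (rule ccontr)
    assume a: "\<not> ?thesis"
    have "s \<le> m\<^sup>2" using that(1) zero_le_power2[of m] by linarith
    then have mn: "7 * n \<le> 5 * (n + m)" using large by simp
    have "n * n - 20 * (n * t) \<le> m * m" using * that(1) by (simp add: power2_eq_square)
    then have "(n + m) * (n - m) \<le> 20 * (n * t)" by (simp add: algebra_simps)
    moreover have "(7 * n) * (15 * t) \<le> (5 * (n + m)) * (n - m)"
      by (rule mult_mono) (use a mn n0 assms(2,4) in linarith)+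
    moreover have "0 < n * t" using n0 assms by simp
    ultimately show False by simp
  qed
qed

text \<open>Here \<open>m = |S|\<close>, and \<open>j\<close> and \<open>r\<close> count the other vertices with at least two and at most one
  neighbour in the bipartite part; \<open>c\<close> counts the edges between the first kind and \<open>S\<close>, and
  \<open>p\<close> is twice the number of edges of the whole graph.\<close>

lemma count_many_removed:
  fixes m j r t c p :: int
  assumes "1 \<le> t" "0 \<le> j" "t + 1 \<le> r" "j \<noteq> 0 \<or> r \<noteq> t + 1" "621 * t\<^sup>2 \<le> m" "j + r \<le> 15 * t"
    and "5 * c \<le> j * (2 * m + 1)"
    and "2 * p \<le> m\<^sup>2 + 4 * c + 4 * r + 2 * j\<^sup>2 + 4 * r * j + 2 * r * (r - 1)"
  shows "2 * p < (m + j + r - t - 1)\<^sup>2 - 1 + 2 * (t + 1) * (t + 2)"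
proof -
  define i where "i = r - t - 1"
  have r: "r = i + t + 1" by (simp add: i_def)
  have tt: "t \<le> t * t" using assms(1) by simp
  have i0: "0 \<le> i" using assms(3) by (simp add: i_def)
  have m: "621 * (t * t) \<le> m" using assms(5) by (simp add: power2_eq_square)
  have "2 \<le> 2 * m - i - 4 * t - 6" using m tt assms(1,2,6) unfolding r by linarith
  then have 1: "i * 2 \<le> i * (2 * m - i - 4 * t - 6)" using i0 by (intro mult_left_mono)
  have "10 \<le> 2 * m - 5 * j - 4 - 20 * r" using m tt assms(1,2,3,6) by linarith
  then have 2: "j * 10 \<le> j * (2 * m - 5 * j - 4 - 20 * r)" using assms(2) by (intro mult_left_mono)
  have ij: "0 \<le> i * j" using i0 assms(2) by simp
  define Q where "Q = 5 * m\<^sup>2 + 4 * (j * (2 * m + 1)) + 20 * r + 10 * j\<^sup>2 + 20 * r * j + 10 * r * (r - 1)"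
  define T where "T = (m + j + r - t - 1)\<^sup>2 - 1 + 2 * (t + 1) * (t + 2)"
  define X where "X = i * (2 * m - i - 4 * t - 6)"
  define Y where "Y = j * (2 * m - 5 * j - 4 - 20 * r)"
  have "10 * p \<le> Q"
    using assms(7,8) by (simp add: Q_def algebra_simps)
  \<comment> \<open>Five times the claimed bound minus the available one. \<open>X\<close> is at
    least \<open>2 * i\<close> and \<open>Y\<close> at least \<open>10 * j\<close>, so one added
    vertex or one excess vertex suffices to beat the constant 5.\<close>
  moreover have "5 * T -
     Q
     = 5 * (X) + Y + 10 * (i * j) - 5"
    by (simp add: T_def Q_def X_def Y_def r power2_eq_square algebra_simps)
  moreover have "1 \<le> i \<or> 1 \<le> j" using assms(2,4) i0 by (auto simp: r)
  ultimately have "2 * p < T" using 1 2 ij i0 assms(2)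
    unfolding X_def[symmetric] Y_def[symmetric] by (elim disjE) linarith+
  then show ?thesis by (simp add: T_def)
qed

text \<open>The case \<open>r = t\<close>, in which \<open>m + j - 1\<close> is
  \<open>n - t - 1\<close>. Two of the \<open>j\<close> vertices together send only about
  \<open>m / 5\<close> edges to \<open>S\<close> instead of about \<open>4 * m / 5\<close>, and this
  deficit decides the comparison.\<close>

lemma count_few_removed:
  fixes m j t c p :: int
  assumes "1 \<le> t" "2 \<le> j" "621 * t\<^sup>2 \<le> m" "j + t \<le> 15 * t"
    and "5 * c \<le> m + 2 + (j - 2) * (2 * m + 1)"
    and "2 * p \<le> m\<^sup>2 + 4 * c + 4 * t + 2 * j\<^sup>2 + 4 * t * j + 2 * t * (t - 1)"
  shows "2 * p < (m + j - 1)\<^sup>2 - 1 + 2 * (t + 1) * (t + 2)"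
proof -
  have tt: "t \<le> t * t" using assms(1) by simp
  have m: "621 * (t * t) \<le> m" using assms(3) by (simp add: power2_eq_square)
  have "1 \<le> 2 * m - 5 * j - 14 - 20 * t" using m tt assms(1,2,4) by linarith
  then have 1: "j * 1 \<le> j * (2 * m - 5 * j - 14 - 20 * t)" using assms(2) by (intro mult_left_mono) auto
  define Q where "Q = 5 * m\<^sup>2 + 4 * (m + 2 + (j - 2) * (2 * m + 1)) + 20 * t + 10 * j\<^sup>2 + 20 * t * j + 10 * t * (t - 1)"
  define T where "T = (m + j - 1)\<^sup>2 - 1 + 2 * (t + 1) * (t + 2)"
  define Y where "Y = j * (2 * m - 5 * j - 14 - 20 * t)"
  have "10 * p \<le> Q"
    using assms(5,6) by (simp add: Q_def algebra_simps)
  moreover have "5 * T -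
    Q
    = Y + 2 * m + 20 * t + 20"
    by (simp add: T_def Q_def Y_def power2_eq_square algebra_simps)
  moreover have "0 \<le> m" using m tt assms(1) by linarith
  ultimately have "2 * p < T" using 1 assms(1,2)
    unfolding Y_def[symmetric] by linarith
  then show ?thesis by (simp add: T_def)
qed

text \<open>A product reaching the floor of \<open>(a + b)^2 / 4\<close> forces
  \<open>(b - a)^2 \<le> 1\<close>.\<close>

lemma balanced_of_prod:
  fixes a b :: nat
  assumes "a * b = (a + b)\<^sup>2 div 4" "a \<le> b"
  shows "a = (a + b) div 2"
proof -
  obtain c where c: "b = a + c" using assms(2) le_Suc_ex by blast
  have "(a + b)\<^sup>2 \<le> 4 * (a * b) + 1" using assms(1) div4_square_ge[of "a + b"] by simp
  then have "c * c \<le> 1" by (simp add: c power2_eq_square algebra_simps)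
  then have "c < 2" by (cases "c \<ge> 2") (use mult_le_mono[of 2 c 2 c] in auto)
  then show ?thesis using c by auto
qed

section \<open>Bipartite part and outside vertices\<close>

context dense_part
begin

text \<open>With \<open>X\<close> one part of the bipartition, these vertices will join the opposite
  part. Two neighbours are required so that one of them differs from any prescribed vertex.\<close>

definition side :: "'a set \<Rightarrow> 'a set" where
  "side X = {v \<in> V - S. 2 \<le> card (nb v X)}"

lemma finite_side: "finite (side X)"
  using finite_V by (simp add: side_def)

lemma side_nb:
  assumes "v \<in> side X"
  obtains b where "b \<in> X" "E v b" "b \<noteq> z"
proof -
  have "\<not> nb v X \<subseteq> {z}"
    using assms card_mono[of "{z}" "nb v X"] by (auto simp: side_def)
  then show thesis using that by (auto simp: nb_def)
qed

end

locale split_part = dense_part +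
  fixes A B :: "'a set"
  assumes AB: "A \<union> B = S" "A \<inter> B = {}"
    and indep_A: "indep A" and indep_B: "indep B"
    and outside_deg: "\<lbrakk>v \<in> V; v \<notin> S\<rbrakk> \<Longrightarrow> 5 * card (nb v S) \<le> 2 * card S + 1"
begin

text \<open>The hypotheses are symmetric in the two parts, so facts proved for \<open>A\<close>
  transfer to \<open>B\<close>.\<close>

lemma swap: "split_part V E k S B A"
  by unfold_locales (use AB indep_A indep_B outside_deg in auto)

lemma A_S: "a \<in> A \<Longrightarrow> a \<in> S" and B_S: "b \<in> B \<Longrightarrow> b \<in> S"
  using AB by auto

lemma finite_A: "finite A" and finite_B: "finite B"
  using finite_S AB by auto

lemma card_AB: "card A + card B = card S"
  using card_Un_disjoint[OF finite_A finite_B AB(2)] AB(1) by simp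

lemma nb_A: "a \<in> A \<Longrightarrow> nb a S = nb a B"
  using AB indep_A by (auto simp: nb_def indep_def)

lemma nb_B: "b \<in> B \<Longrightarrow> nb b S = nb b A"
  using AB indep_B by (auto simp: nb_def indep_def)

lemma nb_A_large: "a \<in> A \<Longrightarrow> 3 * k \<le> card (nb a B)"
  using card_nb_large[OF A_S] nb_A by simp

lemma nb_B_large: "b \<in> B \<Longrightarrow> 3 * k \<le> card (nb b A)"
  using card_nb_large[OF B_S] nb_B by simp

text \<open>A vertex of \<open>A\<close> has a neighbour in \<open>B\<close>, and all neighbours of
  that one in \<open>S\<close> lie in \<open>A\<close>.\<close>

lemma A_large:
  assumes "a \<in> A"
  shows "2 * card S \<le> 5 * card A + 1"
proof -
  have "nb a B \<noteq> {}" using nb_A_large[OF assms] k_ge by auto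
  then obtain b where b: "b \<in> B" by (auto simp: nb_def)
  show ?thesis
    using S_deg[OF B_S[OF b]] nb_B[OF b] card_nb_le[OF finite_A, of b] by simp
qed

text \<open>Both neighbourhoods have about 2/5 of \<open>S\<close> and lie in \<open>B\<close>,
  which has at most about 3/5.\<close>

lemma linked_A:
  assumes "x \<in> A" "y \<in> A"
  shows "linked (3 * k) S x y"
proof -
  have "card (nb x B) + card (nb y B) = card (nb x B \<union> nb y B) + card (nb x B \<inter> nb y B)"
    by (rule card_Un_Int[OF finite_nb finite_nb])
  moreover have "card (nb x B \<union> nb y B) \<le> card B"
    by (rule card_mono[OF finite_B]) (auto simp: nb_def)
  ultimately show ?thesis
    using S_deg[OF A_S[OF assms(1)]] S_deg[OF A_S[OF assms(2)]] A_large[OF assms(1)] card_AB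
      S_large k_ge nb_A[OF assms(1)] nb_A[OF assms(2)]
    unfolding linked_def by simp
qed

lemma even_path:
  assumes "x \<in> A" "y \<in> A" "x \<noteq> y" "z \<notin> A" "1 \<le> l" "l < k"
  shows "\<exists>ys. length ys = 2 * l + 1 \<and> hd ys = x \<and> last ys = y \<and>
    distinct ys \<and> successively E ys \<and> z \<notin> set ys \<and> set ys \<subseteq> S"
proof -
  have "l + 1 \<le> card A" using A_large[OF assms(1)] S_large assms(6) by linarith
  then have "\<exists>ys. length ys = 2 * l + 1 \<and> hd ys = x \<and> last ys = y \<and>
    distinct ys \<and> successively E ys \<and> set ys \<inter> {z} \<subseteq> A \<and> set ys \<subseteq> A \<union> S"
    using assms by (intro clique_even_path[where K = "3 * k"] linked_A finite_A) auto
  then show ?thesis using assms(4) AB(1) by auto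
qed

text \<open>An even path from \<open>a\<close> to a neighbour \<open>a'\<close> of \<open>b\<close>,
  avoiding \<open>b\<close>, is extended by \<open>b\<close>. For \<open>l = 1\<close> the path is
  the edge \<open>ab\<close> itself.\<close>

lemma odd_path:
  assumes "a \<in> A" "b \<in> B" "1 \<le> l" "l \<le> k" "l \<noteq> 1 \<or> E a b"
  shows "\<exists>ys. length ys = 2 * l \<and> hd ys = a \<and> last ys = b \<and>
    distinct ys \<and> successively E ys \<and> set ys \<subseteq> S"
proof (cases "l = 1")
  case True
  have "a \<noteq> b" using assms AB by auto
  then show ?thesis using True assms A_S B_S by (intro exI[of _ "[a, b]"]) auto
next
  case False
  have "\<not> nb b A \<subseteq> {a}"
    using nb_B_large[OF assms(2)] card_mono[of "{a}" "nb b A"] k_ge by auto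
  then obtain a' where a': "a' \<in> A" "E b a'" "a' \<noteq> a" by (auto simp: nb_def)
  have bA: "b \<notin> A" and l: "1 \<le> l - 1" "l - 1 < k" using assms AB False by auto
  obtain ys where ys: "length ys = 2 * (l - 1) + 1" "hd ys = a" "last ys = a'"
    "distinct ys" "successively E ys" "b \<notin> set ys" "set ys \<subseteq> S"
    using even_path[OF assms(1) a'(1) a'(3)[symmetric] bA l] by auto
  have "ys \<noteq> []" using ys(1) by auto
  then show ?thesis using ys a' False assms(2,3) B_S
    by (intro exI[of _ "ys @ [b]"]) (auto simp: successively_append_iff E_commute)
qed

text \<open>A path from \<open>a\<close> to \<open>b\<close> on \<open>2 * k\<close> vertices of
  \<open>S\<close> would close through \<open>v\<close>.\<close>

lemma not_adjacent_both:
  assumes "v \<notin> S" "a \<in> A" "b \<in> B" "E v a"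
  shows "\<not> E v b"
proof -
  obtain ys where ys: "length ys = 2 * k" "hd ys = a" "last ys = b" "distinct ys"
    "successively E ys" "set ys \<subseteq> S"
    using odd_path[OF assms(2,3), of k] k_ge by auto
  then have "v \<notin> set ys" using assms(1) by auto
  from no_cycle1[OF ys(1,4,5) this] show ?thesis using ys assms(4) by (simp add: E_commute)
qed

text \<open>Distinct \<open>a\<close> and \<open>a'\<close> are joined by a path on
  \<open>2 * k - 1\<close> vertices of \<open>S\<close>, which closes through \<open>v\<close> and
  \<open>w\<close>.\<close>

lemma outside_edge:
  assumes "v \<notin> S" "w \<notin> S" "E v w" "a \<in> A" "a' \<in> A" "E v a" "E w a'"
  shows "a = a'"
proof (rule ccontr)
  assume ne: "a \<noteq> a'"
  have vA: "v \<notin> A" and k1: "1 \<le> k - 1" "k - 1 < k" using assms(1) A_S k_ge by auto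
  obtain ys where ys: "length ys = 2 * (k - 1) + 1" "hd ys = a" "last ys = a'" "distinct ys"
    "successively E ys" "set ys \<subseteq> S"
    using even_path[OF assms(4,5) ne vA k1] by auto
  have "v \<notin> set ys" "w \<notin> set ys" "v \<noteq> w" using ys(6) assms E_irrefl by auto
  moreover have "length ys + 1 = 2 * k" using ys(1) k_ge by simp
  ultimately show False
    using no_cycle2[of ys v w] ys assms by (simp add: E_commute)
qed

text \<open>A path from \<open>a\<close> to \<open>b\<close> on \<open>2 * k - 2\<close> vertices of
  \<open>S\<close> would close through \<open>w\<close>, \<open>r\<close> and \<open>v\<close>; for
  \<open>k = 2\<close> it is the edge \<open>ab\<close>.\<close>

lemma outside_path:
  assumes "r \<notin> S" "v \<notin> S" "w \<notin> S" "E r v" "E r w" "v \<noteq> w" "a \<in> A" "b \<in> B" "E v a" "E w b"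
  shows "\<not> E a b"
proof
  assume "E a b"
  moreover have "1 \<le> k - 1" "k - 1 \<le> k" using k_ge by auto
  ultimately obtain ys where ys: "length ys = 2 * (k - 1)" "hd ys = a" "last ys = b" "distinct ys"
    "successively E ys" "set ys \<subseteq> S"
    using odd_path[OF assms(7,8), of "k - 1"] by blast
  have "v \<notin> set ys" "w \<notin> set ys" "r \<notin> set ys" "r \<noteq> w" "r \<noteq> v"
    using ys(6) assms E_irrefl by auto
  moreover have "length ys + 2 = 2 * k" "ys \<noteq> []" using ys(1) k_ge by auto
  ultimately show False
    using no_cycle3[of ys v w r] ys assms by (simp add: E_commute)
qed

lemma side_no_A:
  assumes "v \<in> side B" "a \<in> A"
  shows "\<not> E v a"
proof
  assume "E v a"
  moreover obtain b where "b \<in> B" "E v b" by (rule side_nb[OF assms(1)])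
  ultimately show False
    using not_adjacent_both[of v a b] assms by (auto simp: side_def)
qed

text \<open>Adjacent vertices of \<open>side B\<close> could choose different neighbours in
  \<open>B\<close>, against \<open>outside_edge\<close> with the parts exchanged.\<close>

lemma side_indep: "indep (A \<union> side B)"
  unfolding indep_def
proof (intro ballI)
  fix x y assume xy: "x \<in> A \<union> side B" "y \<in> A \<union> side B"
  show "\<not> E x y"
  proof (cases "x \<in> A \<or> y \<in> A")
    case True
    then show ?thesis
      using xy side_no_A indep_A by (auto simp: indep_def dest: E_sym)
  next
    case False
    then have s: "x \<in> side B" "y \<in> side B" using xy by auto
    obtain b where b: "b \<in> B" "E x b" by (rule side_nb[OF s(1)])
    obtain b' where b': "b' \<in> B" "E y b'" "b' \<noteq> b" by (rule side_nb[OF s(2)])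
    show ?thesis
      using split_part.outside_edge[OF swap, of x y b b'] s b b' by (auto simp: side_def)
  qed
qed

text \<open>The neighbourhoods of \<open>v\<close> and \<open>a\<close> within \<open>B\<close> are
  disjoint, and that of \<open>a\<close> already takes about 2/5 of \<open>S\<close>.\<close>

lemma side_max_deg:
  assumes "v \<in> V" "v \<notin> S" "a \<in> A" "\<And>b. b \<in> B \<Longrightarrow> E v b \<Longrightarrow> \<not> E a b"
  shows "5 * card (nb v B) + 2 * card S \<le> 5 * card B + 1"
proof -
  have "card (nb v B) + card (nb a B) = card (nb v B \<union> nb a B)"
    by (rule card_Un_disjoint[symmetric]) (use assms(4) finite_nb in \<open>auto simp: nb_def\<close>)
  also have "\<dots> \<le> card B"
    by (rule card_mono[OF finite_B]) (auto simp: nb_def)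
  finally show ?thesis using S_deg[OF A_S[OF assms(3)]] nb_A[OF assms(3)] by simp
qed

end

section \<open>Tightness of the edge count\<close>

context sgraph
begin

text \<open>The shape of H(n,t) described inside the graph: complete bipartite between
  \<open>X\<close> and \<open>Y\<close>, with a clique on \<open>R\<close> and \<open>x\<close>.
  Sizes are left open, and \<open>x\<close> may lie in either part.\<close>

definition pendant_clique :: "'a set \<Rightarrow> 'a set \<Rightarrow> 'a set \<Rightarrow> 'a \<Rightarrow> bool" where
  "pendant_clique X Y R x \<longleftrightarrow> X \<union> Y \<union> R = V \<and> X \<inter> Y = {} \<and> (X \<union> Y) \<inter> R = {} \<and> x \<in> X \<union> Y \<and>
    (\<forall>u v. E u v \<longleftrightarrow> u \<noteq> v \<and> (u \<in> X \<and> v \<in> Y \<or> u \<in> Y \<and> v \<in> X \<or> u \<in> R \<and> v \<in> R \<or>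
      u \<in> R \<and> v = x \<or> u = x \<and> v \<in> R))"

lemma scaled_pairs_le:
  assumes "\<And>x. x \<in> S \<Longrightarrow> c * card (nb x T) \<le> d"
  shows "c * pairs S T \<le> card S * d"
  using sum_bounded_above[of S "\<lambda>x. c * card (nb x T)" d] assms
  by (simp add: pairs_def sum_distrib_left)

text \<open>Equality case of the sum bound: one smaller term would make the whole sum
  smaller.\<close>

lemma pairs_eqD:
  assumes "finite S" "\<And>x. x \<in> S \<Longrightarrow> card (nb x T) \<le> d" "card S * d \<le> pairs S T" "x \<in> S"
  shows "card (nb x T) = d"
proof (rule ccontr)
  assume "card (nb x T) \<noteq> d"
  then have "card (nb x T) < d" using assms(2,4) le_neq_implies_less by blast
  then have "pairs S T < (\<Sum>x\<in>S. d)"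
    unfolding pairs_def using assms by (intro sum_strict_mono_ex1) auto
  then show False using assms(3) by simp
qed

end

context split_part
begin

lemma sides_disjoint: "side A \<inter> side B = {}"
proof -
  have False if v: "v \<in> side A" "v \<in> side B" for v
  proof -
    obtain a where "a \<in> A" "E v a" by (rule side_nb[OF v(1)])
    then show False using side_no_A[OF v(2)] by blast
  qed
  then show ?thesis by blast
qed

text \<open>The outside vertices that can be added to the bipartite part: \<open>side B\<close>
  joins \<open>A\<close>, and \<open>side A\<close> joins \<open>B\<close>.\<close>

definition inner :: "'a set" where
  "inner = side A \<union> side B"

definition rest :: "'a set" where
  "rest = V - S - inner"

lemma partition: "S \<union> inner \<union> rest = V" "S \<inter> inner = {}" "(S \<union> inner) \<inter> rest = {}"
  using S_V by (auto simp: inner_def side_def rest_def)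

lemma finite_inner: "finite inner" and finite_rest: "finite rest"
  using finite_V by (auto simp: inner_def finite_side rest_def)

lemma card_V: "card V = card S + card inner + card rest"
  using partition finite_S finite_inner finite_rest
  by (metis card_Un_disjoint finite_UnI)

lemma rest_nb:
  assumes "r \<in> rest"
  shows "card (nb r S) \<le> 1"
proof -
  have r: "r \<notin> S" "card (nb r A) \<le> 1" "card (nb r B) \<le> 1"
    using assms by (auto simp: rest_def inner_def side_def)
  have "nb r A = {} \<or> nb r B = {}"
    using not_adjacent_both[OF r(1)] unfolding nb_def by blast
  then show ?thesis using r AB(1) nb_Un[of r A B] by auto
qed

text \<open>Trivial bounds suffice inside \<open>inner\<close> and between \<open>inner\<close> and
  \<open>rest\<close>, as both sets will have only O(t) vertices.\<close>

lemma pairs_V_le: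
  "pairs V V \<le> 2 * pairs A B + 2 * pairs inner S + 2 * pairs rest S + card inner * card inner
    + 2 * (card rest * card inner) + pairs rest rest"
proof -
  note f = finite_S finite_inner finite_rest
  have "pairs S S = 2 * pairs A B"
    using pairs_Un[OF finite_A finite_B AB(2)] AB(1) indep_pairs[OF indep_A] indep_pairs[OF indep_B]
    by simp
  moreover have "pairs (S \<union> inner) (S \<union> inner) = pairs S S + 2 * pairs inner S + pairs inner inner"
    using pairs_Un[OF f(1,2) partition(2)] pairs_commute[OF f(1,2)] by simp
  moreover have "pairs V V = pairs (S \<union> inner) (S \<union> inner) + 2 * pairs (S \<union> inner) rest + pairs rest rest"
    using pairs_Un[of "S \<union> inner" rest] f partition by simp
  moreover have "pairs (S \<union> inner) rest = pairs rest S + pairs rest inner"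
    using pairs_Un_left[OF f(1,2) partition(2)] pairs_commute f by simp
  moreover have "pairs rest inner \<le> card rest * card inner" "pairs inner inner \<le> card inner * card inner"
    using f by (auto intro: pairs_le_card)
  ultimately show ?thesis by linarith
qed

lemma pairs_A_B_le: "pairs A B \<le> card A * card B"
  by (rule pairs_le_card[OF finite_B])

lemma prod_AB_le: "4 * (card A * card B) \<le> (card S)\<^sup>2"
proof -
  have "int (4 * (card A * card B)) \<le> (int (card A) + int (card B))\<^sup>2"
    using zero_le_power2[of "int (card A) - int (card B)"]
    by (simp add: power2_eq_square algebra_simps)
  then have "int (4 * (card A * card B)) \<le> int ((card S)\<^sup>2)"
    using card_AB by (metis of_nat_add of_nat_power)
  then show ?thesis by linarith
qed

lemma pairs_rest_S_le: "pairs rest S \<le> card rest"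
  using pairs_le[of rest S 1] rest_nb by simp

lemma pairs_rest_rest_le: "pairs rest rest \<le> card rest * (card rest - 1)"
  by (intro pairs_le card_nb_self_le finite_rest)

lemma pairs_V_le_int:
  "2 * int (pairs V V) \<le> (int (card S))\<^sup>2 + 4 * int (pairs inner S) + 4 * int (card rest)
    + 2 * (int (card inner))\<^sup>2 + 4 * int (card rest) * int (card inner)
    + 2 * int (card rest) * (int (card rest) - 1)"
proof -
  have "2 * pairs V V \<le> (card S)\<^sup>2 + 4 * pairs inner S + 4 * card rest
    + 2 * (card inner * card inner) + 4 * (card rest * card inner) + 2 * (card rest * (card rest - 1))"
    using pairs_V_le pairs_A_B_le prod_AB_le pairs_rest_S_le pairs_rest_rest_le by linarith
  then have "int (2 * pairs V V) \<le> int ((card S)\<^sup>2 + 4 * pairs inner S + 4 * card rest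
    + 2 * (card inner * card inner) + 4 * (card rest * card inner) + 2 * (card rest * (card rest - 1)))"
    by linarith
  then show ?thesis
    by (cases "card rest") (simp_all add: power2_eq_square algebra_simps)
qed

lemma pairs_inner_le: "5 * pairs inner S \<le> card inner * (2 * card S + 1)"
  by (rule scaled_pairs_le) (use outside_deg in \<open>auto simp: inner_def side_def\<close>)

lemma joined_indep: "indep (A \<union> side B)" "indep (B \<union> side A)"
  using side_indep split_part.side_indep[OF swap] by auto

lemma joined_disjoint: "(A \<union> side B) \<inter> (B \<union> side A) = {}"
  using AB sides_disjoint by (auto simp: side_def)

lemma joined_Un: "(A \<union> side B) \<union> (B \<union> side A) = V - rest"
  using partition AB unfolding inner_def by blast

lemma indep_insert: "indep X \<Longrightarrow> nb v X = {} \<Longrightarrow> indep (insert v X)"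
  by (auto simp: indep_def nb_def E_irrefl dest: E_sym)

text \<open>Neighbours in \<open>A\<close> and \<open>B\<close> are excluded by
  \<open>not_adjacent_both\<close>. If \<open>x\<close> is in \<open>A\<close> and \<open>y\<close>
  in \<open>side A\<close>, then \<open>y\<close> has a neighbour in \<open>A\<close> other than
  \<open>x\<close>, and the edge \<open>ry\<close> contradicts \<open>outside_edge\<close>; the
  remaining case is symmetric.\<close>

lemma rest_nb_sides:
  assumes "r \<in> rest" "x \<in> A \<union> side B" "E r x" "y \<in> B \<union> side A" "E r y"
  shows "x \<in> side B \<and> y \<in> side A"
proof -
  have r: "r \<notin> S" using assms(1) by (auto simp: rest_def)
  have "\<not> (x \<in> A \<and> y \<in> B)" using not_adjacent_both[OF r] assms by blast
  moreover have False if xy: "x \<in> A" "y \<in> side A"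
  proof -
    obtain a where "a \<in> A" "E y a" "a \<noteq> x" by (rule side_nb[OF xy(2)])
    then show False using outside_edge[OF r, of y x a] assms xy by (auto simp: side_def)
  qed
  moreover have False if xy: "y \<in> B" "x \<in> side B"
  proof -
    obtain b where "b \<in> B" "E x b" "b \<noteq> y" by (rule side_nb[OF xy(2)])
    then show False
      using split_part.outside_edge[OF swap r, of x y b] assms xy by (auto simp: side_def)
  qed
  ultimately show ?thesis using assms by blast
qed

text \<open>By \<open>outside_path\<close> along \<open>y\<close>, \<open>r\<close>,
  \<open>x\<close>, no edge joins the neighbours of \<open>y\<close> in \<open>A\<close> to those of
  \<open>x\<close> in \<open>B\<close>. Hence \<open>x\<close> and \<open>y\<close> together have at
  most about 1/5 of \<open>S\<close> as neighbours; the other vertices of \<open>inner\<close> get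
  the general bound.\<close>

lemma inner_sparse:
  assumes "r \<in> rest" "x \<in> side B" "E r x" "y \<in> side A" "E r y"
  shows "2 \<le> card inner" and "5 * int (pairs inner S) \<le> int (card S) + 2 + (int (card inner) - 2) * (2 * int (card S) + 1)"
proof -
  have out: "r \<notin> S" "x \<notin> S" "y \<notin> S" "x \<in> V" "y \<in> V" using assms by (auto simp: rest_def side_def)
  have xy: "x \<noteq> y" using sides_disjoint assms by blast
  have sub: "{x, y} \<subseteq> inner" using assms by (auto simp: inner_def)
  then have *: "card (inner - {x, y}) = card inner - 2" "2 \<le> card inner"
    using card_Diff_subset[OF _ sub] card_mono[OF finite_inner sub] xy by auto
  then show "2 \<le> card inner" by simp
  obtain a where a: "a \<in> A" "E y a" by (rule side_nb[OF assms(4)])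
  obtain b where b: "b \<in> B" "E x b" by (rule side_nb[OF assms(2)])
  have no: "\<not> E a' b'" if "a' \<in> A" "b' \<in> B" "E y a'" "E x b'" for a' b'
    using outside_path[of r y x a' b'] out that xy assms by blast
  have "5 * card (nb x B) + 2 * card S \<le> 5 * card B + 1"
    by (rule side_max_deg[OF out(4,2) a(1)]) (use no a in blast)
  moreover have "5 * card (nb y A) + 2 * card S \<le> 5 * card A + 1"
    by (rule split_part.side_max_deg[OF swap out(5,3) b(1)]) (use no b E_sym in blast)
  moreover have "nb x S = nb x B" "nb y S = nb y A"
    using side_no_A[OF assms(2)] split_part.side_no_A[OF swap assms(4)] AB(1) by (auto simp: nb_def)
  ultimately have 1: "5 * (card (nb x S) + card (nb y S)) \<le> card S + 2" using card_AB by simp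
  have "5 * pairs (inner - {x, y}) S \<le> card (inner - {x, y}) * (2 * card S + 1)"
    by (rule scaled_pairs_le) (use outside_deg in \<open>auto simp: inner_def side_def\<close>)
  moreover have "pairs inner S = pairs (inner - {x, y}) S + pairs {x, y} S"
    using pairs_Un_left[of "inner - {x, y}" "{x, y}" S] finite_inner sub
    by (metis Diff_disjoint Diff_partition Int_commute Un_commute finite.emptyI finite_Diff finite_insert)
  moreover have "pairs {x, y} S = card (nb x S) + card (nb y S)"
    using xy by (simp add: pairs_def)
  ultimately have "5 * pairs inner S \<le> card S + 2 + (card inner - 2) * (2 * card S + 1)"
    using 1 * by simp
  then have "int (5 * pairs inner S) \<le> int (card S + 2 + (card inner - 2) * (2 * card S + 1))"
    by linarith
  then show "5 * int (pairs inner S) \<le> int (card S) + 2 + (int (card inner) - 2) * (2 * int (card S) + 1)"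
    by (simp only: of_nat_add of_nat_mult of_nat_diff[OF *(2)] of_nat_numeral of_nat_1)
qed

end

section \<open>Structure forced by the extremal number of edges\<close>

locale extremal_part = split_part +
  fixes t :: nat
  assumes t_ge: "1 \<le> t"
    and S_huge: "621 * t\<^sup>2 \<le> card S" "card V \<le> card S + 15 * t"
    and many_pairs: "2 * ((card V - t - 1)\<^sup>2 div 4) + (t + 1) * (t + 2) \<le> pairs V V"
    and far_bipartite: "\<lbrakk>T \<subseteq> V; X \<union> Y = V - T; X \<inter> Y = {}; indep X; indep Y\<rbrakk> \<Longrightarrow> t \<le> card T"
begin

lemma extremal_swap: "extremal_part V E k S B A t"
proof -
  interpret sw: split_part V E k S B A by (rule swap)
  show ?thesis by unfold_locales (use t_ge S_huge many_pairs far_bipartite in auto)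
qed

lemma t_square: "t \<le> t\<^sup>2"
  by (simp add: power2_eq_square)

lemma many_pairs_int:
  "(int (card V) - int t - 1)\<^sup>2 - 1 + 2 * (int t + 1) * (int t + 2) \<le> 2 * int (pairs V V)"
proof -
  have "t + 1 \<le> card V" using S_huge(1) t_square card_V t_ge by linarith
  then show ?thesis using edge_bound_int[OF many_pairs] by simp
qed

lemma t_le_rest: "t \<le> card rest"
  using far_bipartite[OF _ joined_Un joined_disjoint joined_indep] by (auto simp: rest_def)

text \<open>If exactly \<open>t\<close> vertices remained, putting one of them, \<open>r\<close>,
  back into either joined part must fail, since deleting \<open>t - 1\<close> vertices is not
  enough. So \<open>r\<close> has neighbours in both joined parts, and the sparse pair in
  \<open>inner\<close> makes the edge number too small.\<close>

lemma rest_ne_t: "card rest \<noteq> t"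
proof
  assume eq: "card rest = t"
  then obtain r where r: "r \<in> rest" using t_ge by fastforce
  have c: "card (rest - {r}) < t" using r eq finite_rest t_ge by simp
  have V: "(A \<union> side B) \<union> (B \<union> side A) \<union> {r} = V - (rest - {r})"
    using joined_Un r by (auto simp: rest_def)
  have rn: "r \<notin> A \<union> side B" "r \<notin> B \<union> side A" using r joined_Un by auto
  have "nb r (A \<union> side B) \<noteq> {}"
  proof
    assume "nb r (A \<union> side B) = {}"
    then have "t \<le> card (rest - {r})"
      using far_bipartite[of "rest - {r}" "insert r (A \<union> side B)" "B \<union> side A"] V rn joined_disjoint
        indep_insert joined_indep by (auto simp: rest_def)
    then show False using c by simp
  qed
  moreover have "nb r (B \<union> side A) \<noteq> {}"
  proof
    assume "nb r (B \<union> side A) = {}"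
    then have "t \<le> card (rest - {r})"
      using far_bipartite[of "rest - {r}" "A \<union> side B" "insert r (B \<union> side A)"] V rn joined_disjoint
        indep_insert joined_indep by (auto simp: rest_def)
    then show False using c by simp
  qed
  ultimately obtain x y where xy: "x \<in> A \<union> side B" "E r x" "y \<in> B \<union> side A" "E r y"
    unfolding nb_def by blast
  with rest_nb_sides[OF r] have "x \<in> side B" "y \<in> side A" by blast+
  note sp = inner_sparse[OF r this(1) xy(2) this(2) xy(4)]
  have "2 * int (pairs V V) < (int (card S) + int (card inner) - 1)\<^sup>2 - 1 + 2 * (int t + 1) * (int t + 2)"
  proof (rule count_few_removed[OF _ _ _ _ sp(2)])
    show "621 * (int t)\<^sup>2 \<le> int (card S)" using S_huge(1) by (simp flip: of_nat_power)
    show "2 * int (pairs V V) \<le> (int (card S))\<^sup>2 + 4 * int (pairs inner S) + 4 * int t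
      + 2 * (int (card inner))\<^sup>2 + 4 * int t * int (card inner) + 2 * int t * (int t - 1)"
      using pairs_V_le_int eq by simp
  qed (use t_ge sp(1) S_huge(2) card_V eq in auto)
  then show False using many_pairs_int card_V eq by simp
qed

text \<open>At least \<open>t + 1\<close> vertices remain in \<open>rest\<close>; any further one,
  or any vertex in \<open>inner\<close>, costs too many edges.\<close>

lemma tight: "card inner = 0" "card rest = t + 1"
proof -
  have "card inner = 0 \<and> card rest = t + 1"
  proof (rule ccontr)
    assume a: "\<not> ?thesis"
    have "2 * int (pairs V V) < (int (card S) + int (card inner) + int (card rest) - int t - 1)\<^sup>2
      - 1 + 2 * (int t + 1) * (int t + 2)"
    proof (rule count_many_removed[OF _ _ _ _ _ _ _ pairs_V_le_int])
      show "621 * (int t)\<^sup>2 \<le> int (card S)" using S_huge(1) by (simp flip: of_nat_power)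
      show "5 * int (pairs inner S) \<le> int (card inner) * (2 * int (card S) + 1)"
      proof -
        have "int (5 * pairs inner S) \<le> int (card inner * (2 * card S + 1))"
          using pairs_inner_le by linarith
        then show ?thesis by (simp add: algebra_simps)
      qed
    qed (use t_ge S_huge(2) card_V a t_le_rest rest_ne_t in auto)
    then show False using many_pairs_int card_V by simp
  qed
  then show "card inner = 0" "card rest = t + 1" by auto
qed

lemma V_eq: "S \<union> rest = V" and card_S: "card S = card V - t - 1"
  using tight partition(1) finite_inner card_V by auto

lemma tight_pairs:
  "pairs A B = card A * card B" "card A * card B = (card S)\<^sup>2 div 4"
  "pairs rest S = t + 1" "pairs rest rest = (t + 1) * t"
proof -
  \<comment> \<open>With the products named, the required bound and the upper bounds are linear, and
    their sum forces equality in each.\<close>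
  define e f g where "e = (card S)\<^sup>2 div 4" and "f = (t + 1) * t" and "g = card A * card B"
  have "inner = {}" using tight finite_inner by simp
  then have "pairs V V \<le> 2 * pairs A B + 2 * pairs rest S + pairs rest rest"
    using pairs_V_le by (simp add: pairs_def)
  moreover have "2 * e + 2 * (t + 1) + f \<le> pairs V V"
    using many_pairs card_S by (simp add: e_def f_def algebra_simps)
  moreover have "g \<le> e" using prod_AB_le by (simp add: e_def g_def)
  moreover have "pairs rest S \<le> t + 1" "pairs rest rest \<le> f"
    using pairs_rest_S_le pairs_rest_rest_le tight by (auto simp: f_def)
  ultimately have "pairs A B = g \<and> g = e \<and>
    pairs rest S = t + 1 \<and> pairs rest rest = f"
    using pairs_A_B_le[folded g_def] by arith
  then show "pairs A B = card A * card B" "card A * card B = (card S)\<^sup>2 div 4"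
    "pairs rest S = t + 1" "pairs rest rest = (t + 1) * t" by (simp_all add: e_def f_def g_def)
qed

lemma complete_AB: "a \<in> A \<Longrightarrow> b \<in> B \<Longrightarrow> E a b"
proof -
  assume ab: "a \<in> A" "b \<in> B"
  have "card (nb a B) = card B"
    by (rule pairs_eqD[OF finite_A card_nb_le[OF finite_B] _ ab(1)]) (simp add: tight_pairs(1))
  then have "nb a B = B" using card_subset_eq[OF finite_B nb_subset] by blast
  then show "E a b" using ab by (auto simp: nb_def)
qed

lemma complete_rest: "r \<in> rest \<Longrightarrow> r' \<in> rest \<Longrightarrow> r \<noteq> r' \<Longrightarrow> E r r'"
proof -
  assume r: "r \<in> rest" "r' \<in> rest" "r \<noteq> r'"
  have "card (nb r rest) = card rest - 1"
    by (rule pairs_eqD[OF finite_rest card_nb_self_le[OF finite_rest] _ r(1)])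
      (simp_all add: tight_pairs(4) tight(2))
  then have "card (nb r rest) = card (rest - {r})" using r by simp
  moreover have "nb r rest \<subseteq> rest - {r}" by (auto simp: nb_def E_irrefl)
  ultimately have "nb r rest = rest - {r}" using card_subset_eq finite_rest by blast
  then show "E r r'" using r by (auto simp: nb_def)
qed

lemma attached:
  assumes "r \<in> rest"
  obtains x where "nb r S = {x}"
proof -
  have "card (nb r S) = 1"
    by (rule pairs_eqD[OF finite_rest rest_nb _ assms]) (simp_all add: tight_pairs(3) tight(2))
  then show thesis using that by (rule card_1_singletonE)
qed

text \<open>The vertices \<open>r\<close> and \<open>r'\<close> are adjacent, so different
  attachment vertices in \<open>A\<close> would contradict \<open>outside_edge\<close>.\<close>

lemma attached_same_side:
  assumes "r \<in> rest" "r' \<in> rest" "r \<noteq> r'" "nb r S = {x}" "nb r' S = {x'}" "x \<in> A" "x' \<in> A"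
  shows "x = x'"
proof -
  have "r \<notin> S" "r' \<notin> S" using assms by (auto simp: rest_def)
  moreover have "E r x" "E r' x'" using assms(4,5) unfolding nb_def by blast+
  ultimately show ?thesis
    using outside_edge[of r r' x x'] complete_rest[OF assms(1-3)] assms by blast
qed

text \<open>Otherwise \<open>r\<close> can join \<open>B\<close> and \<open>r'\<close> can join
  \<open>A\<close>, so deleting the other \<open>t - 1\<close> vertices of \<open>rest\<close>
  leaves a bipartite graph.\<close>

lemma not_attached_across:
  assumes "r \<in> rest" "r' \<in> rest" "r \<noteq> r'" "nb r S = {x}" "nb r' S = {x'}" "x \<in> A"
  shows "x' \<notin> B"
proof
  assume x': "x' \<in> B"
  let ?T = "rest - {r, r'}"
  have n: "r \<notin> S" "r' \<notin> S" using assms by (auto simp: rest_def)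
  have "nb v A = nb v S \<inter> A" "nb v B = nb v S \<inter> B" for v using AB(1) by (auto simp: nb_def)
  then have "nb r' A = {}" "nb r B = {}" using assms(4-6) x' AB(2) by auto
  then have "indep (insert r' A)" "indep (insert r B)"
    using indep_insert indep_A indep_B by auto
  moreover have "insert r' A \<union> insert r B = V - ?T"
  proof -
    have "S \<inter> rest = {}" by (auto simp: rest_def)
    then show ?thesis using assms(1,2) V_eq AB(1) by blast
  qed
  moreover have "insert r' A \<inter> insert r B = {}" using AB n assms(3) by auto
  moreover have "?T \<subseteq> V" by (auto simp: rest_def)
  ultimately have "t \<le> card ?T"
    using far_bipartite[of ?T "insert r' A" "insert r B"] by blast
  moreover have "card ?T = card rest - card {r, r'}"
    by (rule card_Diff_subset) (use assms in auto)
  ultimately show False using tight(2) assms(3) t_ge by simp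
qed

lemma attached_unique:
  obtains x where "x \<in> S" "\<And>r. r \<in> rest \<Longrightarrow> nb r S = {x}"
proof -
  interpret sw: extremal_part V E k S B A t by (rule extremal_swap)
  have sw_rest: "sw.rest = rest"
    by (auto simp: sw.rest_def rest_def sw.inner_def inner_def)
  obtain r where r: "r \<in> rest" using tight(2) by fastforce
  obtain x where x: "nb r S = {x}" by (rule attached[OF r])
  have "nb r' S = {x}" if r': "r' \<in> rest" "r' \<noteq> r" for r'
  proof -
    obtain x' where x': "nb r' S = {x'}" by (rule attached[OF r'(1)])
    have "x \<in> A \<union> B" "x' \<in> A \<union> B" using x x' nb_subset AB by blast+
    then have "x = x'"
      using attached_same_side[OF r r'(1) r'(2)[symmetric] x x']
        sw.attached_same_side[unfolded sw_rest, OF r r'(1) r'(2)[symmetric] x x']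
        not_attached_across[OF r r'(1) r'(2)[symmetric] x x']
        sw.not_attached_across[unfolded sw_rest, OF r r'(1) r'(2)[symmetric] x x'] by blast
    then show ?thesis using x' by simp
  qed
  then show thesis using that[of x] x nb_subset[of r S] by auto
qed

lemma pendant_clique_parts: "\<exists>x. pendant_clique A B rest x"
proof -
  obtain x where x: "x \<in> S" "\<And>r. r \<in> rest \<Longrightarrow> nb r S = {x}"
    by (rule attached_unique) blast
  have rS: "E r v \<longleftrightarrow> v = x" if "r \<in> rest" "v \<in> S" for r v
    using x(2)[OF that(1)] that(2) unfolding nb_def by blast
  have d: "S \<inter> rest = {}" by (auto simp: rest_def)
  have "E u v \<longleftrightarrow> u \<noteq> v \<and> (u \<in> A \<and> v \<in> B \<or> u \<in> B \<and> v \<in> A \<or> u \<in> rest \<and> v \<in> rest \<or>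
      u \<in> rest \<and> v = x \<or> u = x \<and> v \<in> rest)" (is "_ \<longleftrightarrow> ?P u v") for u v
  proof
    assume e: "E u v"
    then have uv: "u \<in> S \<union> rest" "v \<in> S \<union> rest" "u \<noteq> v" using V_eq E_V E_V2 E_irrefl by auto
    show "?P u v"
    proof (cases "u \<in> rest \<or> v \<in> rest")
      case True
      then show ?thesis using e uv rS[of u v] rS[of v u] E_commute[of u v] by blast
    next
      case False
      then show ?thesis using e uv AB indep_A indep_B unfolding indep_def by blast
    qed
  next
    assume "?P u v"
    then show "E u v"
      using complete_AB complete_rest rS x(1) E_commute by blast
  qed
  then show ?thesis using x(1) AB V_eq d unfolding pendant_clique_def by blast
qed

text \<open>Calling the smaller part \<open>X\<close> fixes its size as the floor of one
  half.\<close>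

lemma ex_pendant_clique:
  "\<exists>X Y R x. pendant_clique X Y R x \<and> card R = t + 1 \<and> card X = (card V - t - 1) div 2"
proof -
  interpret sw: extremal_part V E k S B A t by (rule extremal_swap)
  have sw_rest: "sw.rest = rest"
    by (auto simp: sw.rest_def rest_def sw.inner_def inner_def)
  show ?thesis
  proof (cases "card A \<le> card B")
    case True
    then have "card A = card S div 2"
      using balanced_of_prod[of "card A" "card B"] tight_pairs(2) card_AB by simp
    then show ?thesis using pendant_clique_parts tight(2) card_S by metis
  next
    case False
    then have "card B = card S div 2"
      using balanced_of_prod[of "card B" "card A"] tight_pairs(2) card_AB
      by (simp add: mult.commute add.commute)
    then show ?thesis using sw.pendant_clique_parts sw_rest tight(2) card_S by metis
  qed
qed

end

section \<open>From the edge bound to the extremal structure\<close>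

lemma (in cycle_free_graph) extremal_structure:
  assumes "1 \<le> t" "318 * t\<^sup>2 * k \<le> card V"
    and "2 * ((card V - t - 1)\<^sup>2 div 4) + (t + 1) * (t + 2) \<le> pairs V V"
    and "\<And>T X Y. \<lbrakk>T \<subseteq> V; X \<union> Y = V - T; X \<inter> Y = {}; indep X; indep Y\<rbrakk> \<Longrightarrow> t \<le> card T"
  shows "\<exists>X Y R x. pendant_clique X Y R x \<and> card R = t + 1 \<and> card X = (card V - t - 1) div 2"
proof -
  obtain S where S: "S \<subseteq> V"
    "\<And>v. v \<in> S \<Longrightarrow> 2 * card S \<le> 5 * card (nb v S) + 1"
    "\<And>v. v \<in> V \<Longrightarrow> v \<notin> S \<Longrightarrow> 5 * card (nb v S) \<le> 2 * card S + 1"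
    "5 * pairs V V + 2 * (card S)\<^sup>2 \<le> 5 * pairs S S + 2 * (card V)\<^sup>2"
    by (rule ex_max_density) blast
  have fin: "finite S" using S(1) finite_V finite_subset by blast
  have "t \<le> t\<^sup>2" by (simp add: power2_eq_square)
  moreover have "t\<^sup>2 * 1 \<le> t\<^sup>2 * k" using k_ge by (intro mult_le_mono2) simp
  ultimately have tV: "t + 1 \<le> card V" using assms(1,2) by linarith
  have int_n: "318 * (int t)\<^sup>2 * int k \<le> int (card V)"
  proof -
    have "int (318 * t\<^sup>2 * k) \<le> int (card V)" using assms(2) by linarith
    then show ?thesis by simp
  qed
  have int_S: "5 * int (pairs V V) + 2 * (int (card S))\<^sup>2 \<le> 5 * int (pairs S S) + 2 * (int (card V))\<^sup>2"
  proof -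
    have "int (5 * pairs V V + 2 * (card S)\<^sup>2) \<le> int (5 * pairs S S + 2 * (card V)\<^sup>2)"
      using S(4) by linarith
    then show ?thesis by simp
  qed
  have kt: "2 \<le> int k" "1 \<le> int t" "0 \<le> int (card S)" "int (card S) \<le> int (card V)"
    using k_ge assms(1) S(1) finite_V by (auto intro: card_mono)
  note large = max_density_large[OF kt(1,2) int_n kt(3,4) edge_bound_int[OF assms(3) tV] int_S]
  \<comment> \<open>The trivial bound makes \<open>S\<close> large enough for the bipartition; only
    then does the halved bound hold, which limits the number of outside vertices.\<close>
  have "pairs S S \<le> (card S)\<^sup>2" using pairs_le_card[OF fin] by (simp add: power2_eq_square)
  then have "int (pairs S S) \<le> (int (card S))\<^sup>2" by (simp flip: of_nat_power)
  then have 100: "100 * k \<le> card S" using large(1) by simp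
  interpret dp: dense_part V E k S
    by unfold_locales (use S 100 in auto)
  obtain A B where AB: "A \<union> B = S" "A \<inter> B = {}" "indep A" "indep B" by (rule dp.bipartition)
  interpret sp: split_part V E k S A B
    by unfold_locales (use AB S in auto)
  have "pairs S S = 2 * pairs A B"
    using pairs_Un[OF sp.finite_A sp.finite_B AB(2)] AB by (simp add: indep_pairs)
  then have "2 * pairs S S \<le> (card S)\<^sup>2" using sp.pairs_A_B_le sp.prod_AB_le by linarith
  then have "2 * int (pairs S S) \<le> (int (card S))\<^sup>2" by (simp flip: of_nat_power)
  then have near: "card V \<le> card S + 15 * t" using large(2) 100 by simp
  have "636 * t\<^sup>2 \<le> card V" using large(3) by (simp flip: of_nat_power)
  \<comment> \<open>\<open>621 = 636 - 15\<close>: at most \<open>15 * t\<close>, hence at most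
    \<open>15 * t^2\<close>, vertices lie outside \<open>S\<close>.\<close>
  then have "621 * t\<^sup>2 \<le> card S" using near \<open>t \<le> t\<^sup>2\<close> by linarith
  then interpret ep: extremal_part V E k S A B t
    by unfold_locales (use assms near in auto)
  show ?thesis by (rule ep.ex_pendant_clique)
qed

section \<open>Gluing and isomorphism\<close>

lemma finite_edges: "simple_graph G \<Longrightarrow> finite (edges G)"
  by (rule finite_subset[of "edges G" "Pow (verts G)"]) (auto simp: simple_graph_def)

lemma glue_edges:
  "edges (glue T u K w) = (`) Inl ` edges T \<union> (`) (\<lambda>x. if x = w then Inl u else Inr x) ` edges K"
  by (simp add: glue_def Let_def)

lemma glue_verts:
  "verts (glue T u K w) = Inl ` verts T \<union> (\<lambda>x. if x = w then Inl u else Inr x) ` verts K"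
  by (simp add: glue_def Let_def)

lemma inj_glue_map: "inj (\<lambda>x. if x = w then Inl u else Inr x)"
  by (rule injI) (auto split: if_splits)

text \<open>An edge of \<open>K\<close> has two ends and only \<open>w\<close> is merged, so its
  image contains an \<open>Inr\<close> vertex.\<close>

lemma glue_images_disjoint:
  assumes "simple_graph K"
  shows "(`) Inl ` A \<inter> (`) (\<lambda>x. if x = w then Inl u else Inr x) ` edges K = {}"
proof -
  have False if "e \<in> edges K" "Inl ` e' = (\<lambda>x. if x = w then Inl u else Inr x) ` e" for e e'
  proof -
    have "e \<subseteq> {w}"
    proof
      fix x assume "x \<in> e"
      then have "(if x = w then Inl u else Inr x) \<in> Inl ` e'" using that(2) by simp
      then show "x \<in> {w}" by (auto split: if_splits)
    qed
    then have "card e \<le> 1" using card_mono[of "{w}" e] by simp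
    then show False using assms that(1) by (auto simp: simple_graph_def)
  qed
  then show ?thesis by blast
qed

lemma glue_edge_Inl_Inl:
  assumes "simple_graph K"
  shows "{Inl a, Inl b} \<in> edges (glue T u K w) \<longleftrightarrow> {a, b} \<in> edges T"
proof -
  have eq: "{Inl a, Inl b} = Inl ` {a, b}" by simp
  have "{Inl a, Inl b} \<notin> (`) (\<lambda>x. if x = w then Inl u else Inr x) ` edges K"
    using glue_images_disjoint[OF assms, of "{{a, b}}" w u] by auto
  then show ?thesis
    unfolding glue_edges eq by (simp add: inj_image_mem_iff inj_on_image inj_Inl del: image_insert)
qed

lemma glue_edge_Inl_Inr:
  "{Inl a, Inr q} \<in> edges (glue T u K w) \<longleftrightarrow> a = u \<and> q \<noteq> w \<and> {w, q} \<in> edges K"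
proof -
  let ?f = "\<lambda>x. if x = w then Inl u else Inr x"
  have "{Inl a, Inr q} \<notin> (`) Inl ` edges T" by blast
  moreover have "{Inl a, Inr q} \<in> (`) ?f ` edges K \<longleftrightarrow> a = u \<and> q \<noteq> w \<and> {w, q} \<in> edges K"
  proof
    assume "{Inl a, Inr q} \<in> (`) ?f ` edges K"
    then obtain e where e: "e \<in> edges K" "?f ` e = {Inl a, Inr q}" by blast
    then have "Inl a \<in> ?f ` e" "Inr q \<in> ?f ` e" by auto
    then have *: "a = u" "q \<noteq> w" by (auto split: if_splits)
    then have "?f ` e = ?f ` {w, q}" unfolding e(2) by auto
    then have "e = {w, q}" by (rule inj_image_eq_iff[OF inj_glue_map, THEN iffD1])
    then show "a = u \<and> q \<noteq> w \<and> {w, q} \<in> edges K" using e(1) * by simp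
  next
    assume a: "a = u \<and> q \<noteq> w \<and> {w, q} \<in> edges K"
    then have "{Inl a, Inr q} = ?f ` {w, q}" by auto
    then show "{Inl a, Inr q} \<in> (`) ?f ` edges K" using a by (intro image_eqI) blast+
  qed
  ultimately show ?thesis unfolding glue_edges by blast
qed

lemma glue_edge_Inr_Inr:
  "{Inr p, Inr q} \<in> edges (glue T u K w) \<longleftrightarrow> p \<noteq> w \<and> q \<noteq> w \<and> {p, q} \<in> edges K"
proof -
  let ?f = "\<lambda>x. if x = w then Inl u else Inr x"
  have "{Inr p, Inr q} \<notin> (`) Inl ` edges T" by blast
  moreover have "{Inr p, Inr q} \<in> (`) ?f ` edges K \<longleftrightarrow> p \<noteq> w \<and> q \<noteq> w \<and> {p, q} \<in> edges K"
  proof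
    assume "{Inr p, Inr q} \<in> (`) ?f ` edges K"
    then obtain e where e: "e \<in> edges K" "?f ` e = {Inr p, Inr q}" by blast
    then have "Inr p \<in> ?f ` e" "Inr q \<in> ?f ` e" by auto
    then have *: "p \<noteq> w" "q \<noteq> w" by (auto split: if_splits)
    then have "?f ` e = ?f ` {p, q}" unfolding e(2) by auto
    then have "e = {p, q}" by (rule inj_image_eq_iff[OF inj_glue_map, THEN iffD1])
    then show "p \<noteq> w \<and> q \<noteq> w \<and> {p, q} \<in> edges K" using e(1) * by simp
  next
    assume a: "p \<noteq> w \<and> q \<noteq> w \<and> {p, q} \<in> edges K"
    then have "{Inr p, Inr q} = ?f ` {p, q}" by auto
    then show "{Inr p, Inr q} \<in> (`) ?f ` edges K" using a by (intro image_eqI) blast+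
  qed
  ultimately show ?thesis unfolding glue_edges by blast
qed

lemma simple_turan2: "simple_graph (turan2 m)"
  by (auto simp: simple_graph_def turan2_def)

lemma simple_complete_graph: "simple_graph (complete_graph m)"
  by (auto simp: simple_graph_def complete_graph_def)

lemma simple_glue:
  assumes "simple_graph T" "simple_graph K"
  shows "simple_graph (glue T u K w)"
proof -
  let ?f = "\<lambda>x. if x = w then Inl u else Inr x"
  have "e \<subseteq> verts (glue T u K w) \<and> card e = 2" if e: "e \<in> edges (glue T u K w)" for e
  proof -
    consider e' where "e' \<in> edges T" "e = Inl ` e'" | e' where "e' \<in> edges K" "e = ?f ` e'"
      using e unfolding glue_edges by blast
    then show ?thesis
    proof cases
      case 1
      then have "e' \<subseteq> verts T" "card e' = 2" using assms(1) by (auto simp: simple_graph_def)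
      then show ?thesis using 1(2) by (auto simp: glue_verts card_image)
    next
      case 2
      then have "e' \<subseteq> verts K" "card e' = 2" using assms(2) by (auto simp: simple_graph_def)
      moreover have "card e = card e'"
        unfolding 2(2) by (rule card_image[OF inj_on_subset[OF inj_glue_map subset_UNIV]])
      moreover have "e \<subseteq> ?f ` verts K" unfolding 2(2) by (rule image_mono) fact
      ultimately show ?thesis unfolding glue_verts by (metis le_supI2)
    qed
  qed
  moreover have "finite (verts (glue T u K w))"
    using assms(1,2) unfolding glue_verts simple_graph_def by blast
  ultimately show ?thesis by (simp add: simple_graph_def)
qed

lemma num_edges_turan2: "num_edges (turan2 m) = m\<^sup>2 div 4"
proof -
  let ?h = "m div 2"
  have "edges (turan2 m) = (\<lambda>(a, b). {a, b}) ` ({..<?h} \<times> {?h..<m})"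
    by (auto simp: turan2_def) blast
  moreover have "inj_on (\<lambda>(a, b). {a, b}) ({..<?h} \<times> {?h..<m})"
    by (rule inj_onI) (auto simp: doubleton_eq_iff)
  ultimately have "num_edges (turan2 m) = ?h * (m - ?h)"
    by (simp add: num_edges_def card_image)
  also have "\<dots> = m\<^sup>2 div 4"
  proof (cases "even m")
    case True
    then obtain c where "m = 2 * c" by blast
    then show ?thesis by (simp add: power2_eq_square)
  next
    case False
    then obtain c where c: "m = 2 * c + 1" by (rule oddE)
    then have "m\<^sup>2 = 1 + (c * (c + 1)) * 4" by (simp add: power2_eq_square algebra_simps)
    then have "m\<^sup>2 div 4 = c * (c + 1)" by simp
    then show ?thesis using c by simp
  qed
  finally show ?thesis .
qed

lemma num_edges_complete_graph: "num_edges (complete_graph m) = m choose 2"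
  by (simp add: num_edges_def complete_graph_def n_subsets)

lemma num_edges_glue:
  fixes T :: "'a ugraph" and K :: "'b ugraph"
  assumes "simple_graph T" "simple_graph K"
  shows "num_edges (glue T u K w) = num_edges T + num_edges K"
proof -
  let ?f = "\<lambda>x. if x = w then Inl u else Inr x"
  have "card ((`) (Inl :: 'a \<Rightarrow> 'a + 'b) ` edges T) = card (edges T)"
    by (intro card_image inj_on_image) (rule inj_on_subset[OF inj_Inl subset_UNIV])
  moreover have "card ((`) ?f ` edges K) = card (edges K)"
    by (intro card_image inj_on_image) (rule inj_on_subset[OF inj_glue_map subset_UNIV])
  ultimately show ?thesis
    unfolding num_edges_def glue_edges
    using card_Un_disjoint[OF finite_imageI[OF finite_edges[OF assms(1)]]
        finite_imageI[OF finite_edges[OF assms(2)]] glue_images_disjoint[OF assms(2), of "edges T" w u]]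
    by linarith
qed

lemma num_edges_iso:
  assumes "simple_graph G" "simple_graph H" "G \<simeq> H"
  shows "num_edges G = num_edges H"
proof -
  obtain f where f: "bij_betw f (verts G) (verts H)"
    "\<forall>u\<in>verts G. \<forall>v\<in>verts G. {u, v} \<in> edges G \<longleftrightarrow> {f u, f v} \<in> edges H"
    using assms(3) by (auto simp: graph_iso_def)
  have pair: "\<exists>u v. e = {u, v} \<and> u \<in> verts G \<and> v \<in> verts G" if "simple_graph G" "e \<in> edges G"
    for e and G :: "'c ugraph"
  proof -
    have "e \<subseteq> verts G" "card e = 2" using that by (auto simp: simple_graph_def)
    then show ?thesis by (auto simp: card_2_iff)
  qed
  have "edges H = (`) f ` edges G"
  proof
    show "(`) f ` edges G \<subseteq> edges H"
    proof
      fix e' assume "e' \<in> (`) f ` edges G"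
      then obtain e where "e \<in> edges G" "e' = f ` e" by blast
      with pair[OF assms(1)] f(2) show "e' \<in> edges H" by force
    qed
    show "edges H \<subseteq> (`) f ` edges G"
    proof
      fix e' assume e': "e' \<in> edges H"
      then obtain p q where pq: "e' = {p, q}" "p \<in> verts H" "q \<in> verts H"
        using pair[OF assms(2)] by blast
      then obtain u v where uv: "u \<in> verts G" "v \<in> verts G" "p = f u" "q = f v"
        using bij_betw_imp_surj_on[OF f(1)] by (metis imageE)
      then have "{u, v} \<in> edges G" using f(2) e' pq by blast
      then show "e' \<in> (`) f ` edges G" using uv pq by (intro image_eqI[of _ _ "{u, v}"]) auto
    qed
  qed
  moreover have "inj_on ((`) f) (edges G)"
  proof (rule inj_on_image, rule inj_on_subset[OF bij_betw_imp_inj_on[OF f(1)]])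
    show "\<Union> (edges G) \<subseteq> verts G" using assms(1) by (auto simp: simple_graph_def)
  qed
  ultimately show ?thesis by (simp add: num_edges_def card_image)
qed

lemma num_edges_H_graph:
  assumes "H \<in> H_graphs n t"
  shows "simple_graph H" "num_edges H = (n - t - 1)\<^sup>2 div 4 + ((t + 2) choose 2)"
  using assms simple_turan2 simple_complete_graph unfolding H_graphs_def
  by (auto simp: simple_glue num_edges_glue num_edges_turan2 num_edges_complete_graph)

section \<open>From graph records to adjacency relations\<close>

definition adj :: "'a ugraph \<Rightarrow> 'a \<Rightarrow> 'a \<Rightarrow> bool" where
  "adj G u v \<longleftrightarrow> {u, v} \<in> edges G"

lemma sgraph_adj: "simple_graph G \<Longrightarrow> sgraph (verts G) (adj G)"
  by unfold_locales (auto simp: simple_graph_def adj_def insert_commute)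

text \<open>Each edge is the unordered form of exactly two ordered pairs.\<close>

lemma pairs_adj:
  assumes "simple_graph G"
  shows "sgraph.pairs (adj G) (verts G) (verts G) = 2 * num_edges G"
proof -
  interpret sgraph "verts G" "adj G" by (rule sgraph_adj[OF assms])
  let ?O = "\<lambda>e. {(x, y). {x, y} = e}"
  have O: "finite (?O e) \<and> card (?O e) = 2" if "e \<in> edges G" for e
  proof -
    have "card e = 2" using assms that by (auto simp: simple_graph_def)
    then obtain a b where ab: "e = {a, b}" "a \<noteq> b" by (auto simp: card_2_iff)
    then have "?O e = {(a, b), (b, a)}" by (auto simp: doubleton_eq_iff)
    then show ?thesis using ab by simp
  qed
  have "pairs (verts G) (verts G) = card (SIGMA x:verts G. nb x (verts G))"
    unfolding pairs_def by (rule card_SigmaI[symmetric]) (use finite_V finite_nb in auto)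
  also have "(SIGMA x:verts G. nb x (verts G)) = (\<Union>e\<in>edges G. ?O e)"
    using E_V E_V2 by (auto simp: nb_def adj_def)
  also have "card \<dots> = (\<Sum>e\<in>edges G. card (?O e))"
    by (rule card_UN_disjoint[OF finite_edges[OF assms]]) (use O in auto)
  also have "\<dots> = 2 * num_edges G" using O by (simp add: num_edges_def)
  finally show ?thesis .
qed

lemma cycle_free_graph_adj:
  assumes "simple_graph G" "2 \<le> k" "cycle_free (2 * k + 1) G"
  shows "cycle_free_graph (verts G) (adj G) k"
proof -
  interpret sgraph "verts G" "adj G" by (rule sgraph_adj[OF assms(1)])
  show ?thesis
  proof unfold_locales
    show "2 \<le> k" by (rule assms(2))
  next
    fix vs assume vs: "length vs = 2 * k + 1" "distinct vs" "successively (adj G) vs"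
    show "\<not> adj G (last vs) (hd vs)"
    proof
      assume lh: "adj G (last vs) (hd vs)"
      have ne: "vs \<noteq> []" using vs(1) by auto
      have step: "adj G (vs ! i) (vs ! (Suc i mod (2 * k + 1)))" if "i < 2 * k + 1" for i
      proof (cases "Suc i < length vs")
        case True
        then show ?thesis using vs by (auto simp: successively_conv_nth)
      next
        case False
        \<comment> \<open>The last index: its successor wraps around to 0, which is the closing
          edge.\<close>
        then have "i = length vs - 1" using that vs(1) by simp
        then show ?thesis
          using lh ne vs(1) by (simp add: last_conv_nth hd_conv_nth)
      qed
      then have "set vs \<subseteq> verts G" using E_V vs(1) by (metis in_set_conv_nth subsetI)
      then have "has_cycle (2 * k + 1) G"
        unfolding has_cycle_def using vs step assms(2) by (auto simp: adj_def)
      then show False using assms(3) by simp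
    qed
  qed
qed

lemma d2_le:
  assumes G: "simple_graph G" and T: "T \<subseteq> verts G" and XY: "X \<union> Y = verts G - T" "X \<inter> Y = {}"
    and ind: "sgraph.indep (adj G) X" "sgraph.indep (adj G) Y"
  shows "d2 G \<le> card T"
proof -
  interpret sgraph "verts G" "adj G" by (rule sgraph_adj[OF G])
  have "bipartite (delete_verts G T)"
    unfolding bipartite_def
  proof (rule exI[of _ X], rule exI[of _ Y], intro conjI ballI)
    show "X \<union> Y = verts (delete_verts G T)" "X \<inter> Y = {}" using XY by (auto simp: delete_verts_def)
    fix e assume "e \<in> edges (delete_verts G T)"
    then have e: "e \<in> edges G" "e \<subseteq> X \<union> Y" using XY by (auto simp: delete_verts_def)
    then obtain u v where uv: "e = {u, v}" using G by (auto simp: simple_graph_def card_2_iff)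
    have "adj G u v" using e uv by (simp add: adj_def)
    then have "u \<in> X \<and> v \<in> Y \<or> v \<in> X \<and> u \<in> Y"
      using e(2) uv ind by (auto simp: indep_def)
    then show "\<exists>a\<in>X. \<exists>b\<in>Y. e = {a, b}" using uv by (auto simp: insert_commute)
  qed
  then have "card T \<in> {card T | T. T \<subseteq> verts G \<and> bipartite (delete_verts G T)}" using T by blast
  moreover have "finite {card T | T. T \<subseteq> verts G \<and> bipartite (delete_verts G T)}"
    using finite_V by simp
  ultimately show ?thesis unfolding d2_def by (rule Min_le[rotated])
qed

text \<open>\<open>X\<close> and \<open>Y\<close> are sent to the two parts of the bipartite graph
  and \<open>R\<close> to the clique vertices from 1 on. Clique vertex 0 is the glued one and is
  represented by the image of \<open>x\<close>.\<close>

lemma pendant_clique_iso: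
  assumes G: "simple_graph G" and pc: "sgraph.pendant_clique (verts G) (adj G) X Y R x"
    and R: "card R = t + 1" and X: "card X = (card (verts G) - t - 1) div 2"
  shows "\<exists>H\<in>H_graphs (card (verts G)) t. G \<simeq> H"
proof -
  interpret sgraph "verts G" "adj G" by (rule sgraph_adj[OF G])
  have pc: "X \<union> Y \<union> R = verts G" "X \<inter> Y = {}" "(X \<union> Y) \<inter> R = {}" "x \<in> X \<union> Y"
    and adj: "\<And>u v. adj G u v \<longleftrightarrow> u \<noteq> v \<and> (u \<in> X \<and> v \<in> Y \<or> u \<in> Y \<and> v \<in> X \<or> u \<in> R \<and> v \<in> R \<or>
      u \<in> R \<and> v = x \<or> u = x \<and> v \<in> R)"
    using pc unfolding pendant_clique_def by blast+
  define N where "N = card (verts G) - t - 1"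
  let ?h = "N div 2"
  have fin: "finite X" "finite Y" "finite R" using finite_V pc(1) by (metis finite_Un)+
  have "card (X \<union> Y \<union> R) = card X + card Y + card R"
    using card_Un_disjoint[OF _ fin(3) pc(3)] card_Un_disjoint[OF fin(1,2) pc(2)] fin by simp
  then have Y: "card Y = N - ?h" using pc(1) R X by (simp add: N_def)
  obtain f where f: "bij_betw f X {..<?h}"
    using finite_same_card_bij[OF fin(1), of "{..<?h}"] X by (auto simp: N_def)
  obtain g where g: "bij_betw g Y {?h..<N}"
    using finite_same_card_bij[OF fin(2), of "{?h..<N}"] Y by auto
  obtain h where h: "bij_betw h R {1..<t + 2}"
    using finite_same_card_bij[OF fin(3), of "{1..<t + 2}"] R by auto
  define F where "F v = (if v \<in> X then Inl (f v) else if v \<in> Y then Inl (g v) else Inr (h v))" for v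
  define u where "u = (if x \<in> X then f x else g x)"
  let ?H = "glue (turan2 N) u (complete_graph (t + 2)) 0"
  have FX: "F v = Inl (f v)" "f v < ?h" if "v \<in> X" for v
    using that f by (auto simp: F_def bij_betw_def)
  have FY: "F v = Inl (g v)" "?h \<le> g v" "g v < N" if "v \<in> Y" for v
    using that g pc(2) by (auto simp: F_def bij_betw_def)
  have FR: "F v = Inr (h v)" "0 < h v" "h v < t + 2" if "v \<in> R" for v
    using that bij_betwE[OF h] pc(3) by (auto simp: F_def Suc_le_eq)
  have Fx: "F x = Inl u" using pc(4) by (auto simp: F_def u_def)
  have uN: "u < N" using pc(4) FX(2)[of x] FY(3)[of x] by (auto simp: u_def)
  have bij: "bij_betw F (verts G) (Inl ` {..<N} \<union> Inr ` {1..<t + 2})"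
  proof -
    have "bij_betw (Inl \<circ> f) X (Inl ` {..<?h})"
      by (rule bij_betw_trans[OF f inj_on_imp_bij_betw]) simp
    then have 1: "bij_betw F X (Inl ` {..<?h})"
      by (rule bij_betw_cong[THEN iffD1, rotated]) (simp add: FX)
    have "bij_betw (Inl \<circ> g) Y (Inl ` {?h..<N})"
      by (rule bij_betw_trans[OF g inj_on_imp_bij_betw]) simp
    then have 2: "bij_betw F Y (Inl ` {?h..<N})"
      by (rule bij_betw_cong[THEN iffD1, rotated]) (simp add: FY)
    have "bij_betw (Inr \<circ> h) R (Inr ` {1..<t + 2})"
      by (rule bij_betw_trans[OF h inj_on_imp_bij_betw]) simp
    then have 3: "bij_betw F R (Inr ` {1..<t + 2})"
      by (rule bij_betw_cong[THEN iffD1, rotated]) (simp add: FR)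
    have "{..<?h} \<union> {?h..<N} = {..<N}" by auto
    then have im: "Inl ` {..<?h} \<union> Inl ` {?h..<N} = Inl ` {..<N}" by (metis image_Un)
    have "bij_betw F (X \<union> Y) (Inl ` {..<?h} \<union> Inl ` {?h..<N})"
      by (rule bij_betw_combine[OF 1 2]) auto
    then have "bij_betw F (X \<union> Y \<union> R) (Inl ` {..<N} \<union> Inr ` {1..<t + 2})"
      unfolding im by (rule bij_betw_combine[OF _ 3]) auto
    then show ?thesis using pc(1) by simp
  qed
  have "verts ?H = Inl ` {..<N} \<union> Inr ` {1..<t + 2}"
    using uN by (auto simp: glue_verts turan2_def complete_graph_def)
  with bij have bijH: "bij_betw F (verts G) (verts ?H)" by simp
  have inj: "F a = F b \<longleftrightarrow> a = b" if "a \<in> verts G" "b \<in> verts G" for a b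
    using bij that by (auto simp: bij_betw_def inj_on_def)
  have turan: "{a, b} \<in> edges (turan2 N) \<longleftrightarrow> a < ?h \<and> ?h \<le> b \<and> b < N \<or> b < ?h \<and> ?h \<le> a \<and> a < N" for a b
    by (auto simp: turan2_def doubleton_eq_iff)
  have compl: "{p, q} \<in> edges (complete_graph m) \<longleftrightarrow> p < m \<and> q < m \<and> p \<noteq> q" for p q m
    by (auto simp: complete_graph_def)
  note edge = glue_edge_Inl_Inl[OF simple_complete_graph] glue_edge_Inl_Inr glue_edge_Inr_Inr
    insert_commute[of "Inr _" "Inl _"] turan compl
  have "{a, b} \<in> edges G \<longleftrightarrow> {F a, F b} \<in> edges ?H" if ab: "a \<in> verts G" "b \<in> verts G" for a b
  proof -
    have hyp: "{a, b} \<in> edges G \<longleftrightarrow> a \<noteq> b \<and> (a \<in> X \<and> b \<in> Y \<or> a \<in> Y \<and> b \<in> X \<or> a \<in> R \<and> b \<in> R \<or>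
      a \<in> R \<and> b = x \<or> a = x \<and> b \<in> R)" using adj[of a b] by (simp add: adj_def)
    have attach: "{F a, F b} \<in> edges ?H \<longleftrightarrow> a = x" if mem: "a \<in> X \<union> Y" "b \<in> R" for a b
    proof -
      obtain c where c: "F a = Inl c" using mem(1) FX(1) FY(1) by blast
      have "a = x \<longleftrightarrow> c = u" using inj[of a x] mem pc c Fx by auto
      then show ?thesis using c FR[OF mem(2)] by (simp add: edge)
    qed
    consider "a \<in> X \<union> Y" "b \<in> X \<union> Y" | "a \<in> X \<union> Y" "b \<in> R" | "a \<in> R" "b \<in> X \<union> Y" | "a \<in> R" "b \<in> R"
      using ab pc(1) by blast
    then show ?thesis
    proof cases
      case 1
      then have "a \<notin> R" "b \<notin> R" using pc(3) by auto
      moreover have "{F a, F b} \<in> edges ?H \<longleftrightarrow> a \<in> X \<and> b \<in> Y \<or> a \<in> Y \<and> b \<in> X"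
        using 1 FX[of a] FX[of b] FY[of a] FY[of b] pc(2) by (auto simp: edge)
      ultimately show ?thesis using hyp pc(2) by auto
    next
      case 2
      then show ?thesis using hyp attach[of a b] pc by auto
    next
      case 3
      then show ?thesis using hyp attach[of b a] pc by (auto simp: insert_commute)
    next
      case 4
      then have "h a = h b \<longleftrightarrow> a = b" using inj[OF ab] FR by simp
      then show ?thesis using 4 hyp FR[of a] FR[of b] by (simp add: edge)
    qed
  qed
  then have "G \<simeq> ?H" unfolding graph_iso_def using bijH by blast
  moreover have "?H \<in> H_graphs (card (verts G)) t"
    unfolding H_graphs_def N_def[symmetric] using uN by (auto simp: turan2_def complete_graph_def)
  ultimately show ?thesis by blast
qed

theorem theorem1p3:
  fixes G :: "'a ugraph" and n k t :: nat
  assumes "k \<ge> 2" and "1 \<le> t" and "t \<le> 2 * k - 2" and "n \<ge> 318 * t\<^sup>2 * k"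
    and "simple_graph G" and "card (verts G) = n"
    and "cycle_free (2 * k + 1) G"
    and "d2 G \<ge> t"
  shows "num_edges G \<le> (n - t - 1)\<^sup>2 div 4 + ((t + 2) choose 2) \<and>
    (num_edges G = (n - t - 1)\<^sup>2 div 4 + ((t + 2) choose 2) \<longleftrightarrow> (\<exists>H\<in>H_graphs n t. G \<simeq> H))"
proof -
  let ?m = "(n - t - 1)\<^sup>2 div 4 + ((t + 2) choose 2)"
  interpret cycle_free_graph "verts G" "adj G" k
    by (rule cycle_free_graph_adj[OF assms(5,1,7)])
  have extremal: "num_edges G = ?m" if "H \<in> H_graphs n t" "G \<simeq> H" for H
    using num_edges_iso[OF assms(5) num_edges_H_graph(1)] num_edges_H_graph(2) that by metis
  \<comment> \<open>This implication yields both claims: reaching the bound forces isomorphism to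
    some \<open>H\<close>, whose edge number equals the bound, so it cannot be exceeded.\<close>
  have iso: "\<exists>H\<in>H_graphs n t. G \<simeq> H" if "?m \<le> num_edges G"
  proof -
    have "2 * ((t + 2) choose 2) = (t + 1) * (t + 2)" by (simp add: choose_two)
    then have "2 * ((card (verts G) - t - 1)\<^sup>2 div 4) + (t + 1) * (t + 2) \<le> pairs (verts G) (verts G)"
      using that pairs_adj[OF assms(5)] unfolding assms(6) by linarith
    moreover have "t \<le> card T" if "T \<subseteq> verts G" "X \<union> Y = verts G - T" "X \<inter> Y = {}" "indep X" "indep Y" for T X Y
      using d2_le[OF assms(5) that] assms(8) by linarith
    ultimately obtain X Y R x where "pendant_clique X Y R x" "card R = t + 1"
      "card X = (card (verts G) - t - 1) div 2"
      using extremal_structure[of t] assms(2,4,6) by blast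
    then show ?thesis using pendant_clique_iso[OF assms(5)] assms(6) by blast
  qed
  show ?thesis
    using extremal iso by (metis le_refl nle_le)
qed

end
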